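(* Let $(X,\Sigma,\mu)$ be a complete $\sigma$-finite measure space, $\mathcal{A}\subseteq\Sigma$ a sub-$\sigma$-algebra such that $\mu|_{\mathcal{A}}$ is $\sigma$-finite, $E=E^{\mathcal{A}}$ the associated conditional expectation operator, and $u,w\in\mathcal{D}(E)$. Suppose $T=M_wEM_u:L^2(\Sigma)\to L^2(\Sigma)$, $T(f)=wE(uf)$, is bounded. Let $S=\{x: E(|u|^2)(x)\ne 0\}$ and $G=\{x: E(|w|^2)(x)\neq 0\}$. Then the unique polar decomposition of $T$ is $T=U|T|$, where for all $f\in L^2(\Sigma)$ $$|T|(f)=\left(\frac{E(|w|^2)}{E(|u|^2)}\right)^{1/2}\chi_S\,\bar u\,E(uf),\qquad U(f)=\left(\frac{\chi_{S\cap G}}{E(|w|^2)E(|u|^2)}\right)^{1/2}w\,E(uf).$$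
   Context: Functions are complex valued and identified when equal $\mu$-a.e.; relations between functions or sets hold up to $\mu$-null sets. $L^p(\Sigma)=L^p(X,\Sigma,\mu)$ and $L^p(\mathcal{A})=L^p(X,\mathcal{A},\mu|_{\mathcal{A}})$. $L^0(\Sigma)$ (resp. $L^0(\mathcal{A})$) is the space of a.e. finite valued $\Sigma$-measurable (resp. $\mathcal{A}$-measurable) functions. For measurable $f\ge 0$, $E(f)$ is the a.e. unique $\mathcal{A}$-measurable $[0,\infty]$-valued function with $\int_A f\,d\mu=\int_A E(f)\,d\mu$ for all $A\in\mathcal{A}$; it is extended linearly to all $f\in L^0(\Sigma)$, with $E(f)$ defined on the set where $E(|f|)<\infty$. $\mathcal{D}(E)=\{g\in L^0(\Sigma): E(|g|)\in L^0(\mathcal{A})\}$. $M_g$ denotes multiplication by $g$ and $\chi_A$ the characteristic function of $A$. Convention: a product one of whose factors is $0$ at a point is $0$ there, even if other factors are infinite or undefined at that point, and $1/\infty=0$ (note that $w=0$ a.e. on $\{E(|w|^2)=0\}$ and $u=0$ a.e. on $\{E(|u|^2)=0\}$). "$T$ is bounded on $L^2(\Sigma)$" means that for every $f\in L^2(\Sigma)$ one has $E(|uf|)<\infty$ a.e. on $\{E(|w|^2)>0\}$, $wE(uf)\in L^2(\Sigma)$ (set equal to $0$ on $\{E(|w|^2)=0\}$), and there is a constant $C$ with $\|wE(uf)\|_2\le C\|f\|_2$ for all such $f$. The unique polar decomposition of a bounded operator $T$ on a Hilbert space is the factorization $T=U|T|$ with $|T|=(T^*T)^{1/2}$, $U$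 a partial isometry, and $\ker U=\ker|T|=\ker T$. *)

theory Defs
  imports "HOL-Probability.Probability"
begin

text \<open>
  A sub-sigma-algebra of \<open>M\<close> is represented, as in \<^theory>\<open>HOL-Probability.Conditional_Expectation\<close>,
  by a measure \<open>A\<close> with \<open>subalgebra M A\<close>; only \<open>sets A\<close> matters.  Extended nonnegative conditional
  expectations are the library's \<open>nn_cond_exp M A\<close>.
\<close>

text \<open>
  Complex conditional expectation of a measurable \<open>f\<close>, which is defined only where
  \<open>E(|f|) < \<infinity>\<close>.  Elsewhere the value is fixed to \<open>0\<close>; this also realises the
  convention that \<open>0\<close> times an undefined factor is \<open>0\<close>.
\<close>

definition ccond_exp ::
    "'a measure \<Rightarrow> 'a measure \<Rightarrow> ('a \<Rightarrow> complex) \<Rightarrow> 'a \<Rightarrow> complex" where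
  "ccond_exp M A f x =
     (if nn_cond_exp M A (\<lambda>y. ennreal (cmod (f y))) x < \<infinity>
      then Complex (real_cond_exp M A (\<lambda>y. Re (f y)) x) (real_cond_exp M A (\<lambda>y. Im (f y)) x)
      else 0)"

definition cond_exp_dom :: "'a measure \<Rightarrow> 'a measure \<Rightarrow> ('a \<Rightarrow> complex) set" where
  "cond_exp_dom M A =
     {g \<in> borel_measurable M. AE x in M. nn_cond_exp M A (\<lambda>y. ennreal (cmod (g y))) x < \<infinity>}"

definition cond_sq :: "'a measure \<Rightarrow> 'a measure \<Rightarrow> ('a \<Rightarrow> complex) \<Rightarrow> 'a \<Rightarrow> ennreal" where
  "cond_sq M A g = nn_cond_exp M A (\<lambda>y. ennreal ((cmod (g y))\<^sup>2))"

text \<open>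
  The Hilbert space of square-integrable functions.  Elements are functions rather than
  equivalence classes, so every equation between elements below is an a.e. equation.
\<close>

definition L2 :: "'a measure \<Rightarrow> ('a \<Rightarrow> complex) set" where
  "L2 M = {f \<in> borel_measurable M. integrable M (\<lambda>x. (cmod (f x))\<^sup>2)}"

definition L2_inner :: "'a measure \<Rightarrow> ('a \<Rightarrow> complex) \<Rightarrow> ('a \<Rightarrow> complex) \<Rightarrow> complex" where
  "L2_inner M f g = (\<integral>x. f x * cnj (g x) \<partial>M)"

definition L2_norm :: "'a measure \<Rightarrow> ('a \<Rightarrow> complex) \<Rightarrow> real" where
  "L2_norm M f = sqrt (\<integral>x. (cmod (f x))\<^sup>2 \<partial>M)"

type_synonym 'a fun_op = "('a \<Rightarrow> complex) \<Rightarrow> ('a \<Rightarrow> complex)"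

text \<open>
  Bounded linear operators on \<open>L2 M\<close>.  Linearity and boundedness together imply that a.e. equal
  arguments have a.e. equal images, so such an operator descends to equivalence classes.
\<close>

definition L2_bounded_op :: "'a measure \<Rightarrow> 'a fun_op \<Rightarrow> bool" where
  "L2_bounded_op M T \<longleftrightarrow>
     (\<forall>f\<in>L2 M. T f \<in> L2 M) \<and>
     (\<forall>f\<in>L2 M. \<forall>g\<in>L2 M. AE x in M. T (\<lambda>y. f y + g y) x = T f x + T g x) \<and>
     (\<forall>c. \<forall>f\<in>L2 M. AE x in M. T (\<lambda>y. c * f y) x = c * T f x) \<and>
     (\<exists>C. \<forall>f\<in>L2 M. L2_norm M (T f) \<le> C * L2_norm M f)"

definition L2_op_eq :: "'a measure \<Rightarrow> 'a fun_op \<Rightarrow> 'a fun_op \<Rightarrow> bool" where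
  "L2_op_eq M T T' \<longleftrightarrow> (\<forall>f\<in>L2 M. AE x in M. T f x = T' f x)"

definition L2_adjoint :: "'a measure \<Rightarrow> 'a fun_op \<Rightarrow> 'a fun_op \<Rightarrow> bool" where
  "L2_adjoint M T T' \<longleftrightarrow>
     L2_bounded_op M T' \<and>
     (\<forall>f\<in>L2 M. \<forall>g\<in>L2 M. L2_inner M (T f) g = L2_inner M f (T' g))"

definition L2_positive :: "'a measure \<Rightarrow> 'a fun_op \<Rightarrow> bool" where
  "L2_positive M P \<longleftrightarrow>
     L2_bounded_op M P \<and> (\<forall>f\<in>L2 M. L2_inner M (P f) f \<in> \<real>\<^sub>\<ge>\<^sub>0)"

definition L2_pos_sqrt :: "'a measure \<Rightarrow> 'a fun_op \<Rightarrow> 'a fun_op \<Rightarrow> bool" where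
  "L2_pos_sqrt M B P \<longleftrightarrow> L2_positive M P \<and> L2_op_eq M (P \<circ> P) B"

text \<open>\<open>P\<close> is \<open>|T|\<close>, the positive square root of \<open>T\<^sup>* T\<close>.\<close>

definition L2_abs_op :: "'a measure \<Rightarrow> 'a fun_op \<Rightarrow> 'a fun_op \<Rightarrow> bool" where
  "L2_abs_op M T P \<longleftrightarrow> (\<exists>T'. L2_adjoint M T T' \<and> L2_pos_sqrt M (T' \<circ> T) P)"

definition L2_ker :: "'a measure \<Rightarrow> 'a fun_op \<Rightarrow> ('a \<Rightarrow> complex) set" where
  "L2_ker M T = {f \<in> L2 M. AE x in M. T f x = 0}"

text \<open>A partial isometry is isometric on the orthogonal complement of its kernel.\<close>

definition L2_partial_isometry :: "'a measure \<Rightarrow> 'a fun_op \<Rightarrow> bool" where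
  "L2_partial_isometry M U \<longleftrightarrow>
     L2_bounded_op M U \<and>
     (\<forall>f\<in>L2 M. (\<forall>g\<in>L2_ker M U. L2_inner M f g = 0) \<longrightarrow> L2_norm M (U f) = L2_norm M f)"

definition L2_polar_decomp :: "'a measure \<Rightarrow> 'a fun_op \<Rightarrow> 'a fun_op \<Rightarrow> 'a fun_op \<Rightarrow> bool" where
  "L2_polar_decomp M T U P \<longleftrightarrow>
     L2_bounded_op M T \<and>
     L2_abs_op M T P \<and>
     L2_partial_isometry M U \<and>
     L2_op_eq M T (U \<circ> P) \<and>
     L2_ker M U = L2_ker M P \<and>
     L2_ker M P = L2_ker M T"

text \<open>
  The operator \<open>M\<^sub>w E M\<^sub>u\<close>.  Since \<open>w = 0\<close> a.e. on \<open>{E(|w|\<^sup>2) = 0}\<close> and \<open>ccond_exp\<close> is total,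
  its values are \<open>0\<close> a.e. on that set.
\<close>

definition wce_op ::
    "'a measure \<Rightarrow> 'a measure \<Rightarrow> ('a \<Rightarrow> complex) \<Rightarrow> ('a \<Rightarrow> complex) \<Rightarrow> 'a fun_op" where
  "wce_op M A w u f = (\<lambda>x. w x * ccond_exp M A (\<lambda>y. u y * f y) x)"

text \<open>
  Boundedness of \<open>M\<^sub>w E M\<^sub>u\<close> includes that \<open>E(uf)\<close> is genuinely defined, not just totalised,
  wherever \<open>E(|w|\<^sup>2) > 0\<close>.
\<close>

definition wce_bounded ::
    "'a measure \<Rightarrow> 'a measure \<Rightarrow> ('a \<Rightarrow> complex) \<Rightarrow> ('a \<Rightarrow> complex) \<Rightarrow> bool" where
  "wce_bounded M A w u \<longleftrightarrow>
     (\<forall>f\<in>L2 M. (AE x in M. cond_sq M A w x > 0 \<longrightarrow>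
                   nn_cond_exp M A (\<lambda>y. ennreal (cmod (u y * f y))) x < \<infinity>) \<and>
                wce_op M A w u f \<in> L2 M) \<and>
     (\<exists>C. \<forall>f\<in>L2 M. L2_norm M (wce_op M A w u f) \<le> C * L2_norm M f)"

end

theory Submission
  imports Defs
begin

text \<open>
  Write \<open>p = E(|w|\<^sup>2)\<close> and \<open>q = E(|u|\<^sup>2)\<close>.  Boundedness of \<open>T\<close> forces \<open>p q \<le> C\<close> a.e. (so both are finite
  and positive on \<open>K = S \<inter> G\<close>, up to a null set).  With \<open>v = \<chi>\<^sub>K w / p\<^bsup>1/2\<^esup>\<close>, \<open>z = \<chi>\<^sub>K u / q\<^bsup>1/2\<^esup>\<close> and the
  bounded function \<open>a = \<chi>\<^sub>K (p q)\<^bsup>1/2\<^esup>\<close>, the three operators are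
  \<open>T = M\<^bsub>a v\<^esub> E M\<^sub>z\<close>, \<open>|T| = M\<^bsub>a cnj z\<^esub> E M\<^sub>z\<close> and \<open>U = M\<^sub>v E M\<^sub>z\<close>, where \<open>E(|v|\<^sup>2) = E(|z|\<^sup>2) = \<chi>\<^sub>K\<close>.
  For operators of this shape adjoints and products are again of this shape, by the pull-out
  property of \<open>E\<close>, and everything reduces to pointwise identities.  Uniqueness of \<open>|T|\<close> is uniqueness
  of positive square roots; uniqueness of \<open>U\<close> follows since \<open>ran |T| + ker |T|\<close> is dense.
\<close>

subsection \<open>Square-integrable functions and operators\<close>

text \<open>Separately the factors of \<open>T\<close> behave badly: \<open>p\<close> may be
  infinite where \<open>q = 0\<close> and conversely, and \<open>E(u f)\<close> may be undefined
  where \<open>p = 0\<close>. Only the product \<open>p q\<close> is controlled. Dividing each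
  weight by the root of its own conditional second moment gives weights that cause no trouble, and
  the size of \<open>T\<close> is concentrated in the one function \<open>a\<close>, which passes
  through \<open>E\<close> because it is measurable for the subalgebra. Then \<open>U\<close> is
  \<open>T\<close> with \<open>a\<close> removed, \<open>|T|\<close> is \<open>T\<close> with
  \<open>v\<close> replaced by \<open>cnj z\<close>, and all three have the kernel
  \<open>{f. E(z f) = 0}\<close>, whose orthogonal complement has the explicit projection
  \<open>Qop\<close>. This projection and an explicit approximate inverse of \<open>|T|\<close> take
  the place of abstract arguments about closed subspaces. As elements of \<open>L2 M\<close> are
  functions and not classes, the result is established for the normal forms and then transferred
  along a.e. equality of operators.\<close>

lemma borel_measurable_cnj [measurable]: "cnj \<in> borel_measurable borel"
  by (intro borel_measurable_continuous_onI continuous_intros)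

lemma L2_I: "f \<in> borel_measurable M \<Longrightarrow> integrable M (\<lambda>x. (cmod (f x))\<^sup>2) \<Longrightarrow> f \<in> L2 M"
  by (simp add: L2_def)

lemma L2_measurable [measurable_dest]: "f \<in> L2 M \<Longrightarrow> f \<in> borel_measurable M"
  by (simp add: L2_def)

lemma L2_integrable: "f \<in> L2 M \<Longrightarrow> integrable M (\<lambda>x. (cmod (f x))\<^sup>2)"
  by (simp add: L2_def)

lemma L2_cong_AE:
  assumes "f \<in> L2 M" "g \<in> borel_measurable M" "AE x in M. f x = g x"
  shows "g \<in> L2 M"
proof (rule L2_I)
  show "integrable M (\<lambda>x. (cmod (g x))\<^sup>2)"
    using assms L2_measurable[OF assms(1)]
    by (intro integrable_cong_AE_imp[OF L2_integrable[OF assms(1)]]) auto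
qed (use assms in auto)

lemma L2_cmult [intro]:
  assumes "f \<in> L2 M" shows "(\<lambda>x. c * f x) \<in> L2 M"
  using assms by (auto simp: L2_def norm_mult power_mult_distrib)

lemma cmod_add_sq_le: "(cmod (a + b))\<^sup>2 \<le> 2 * (cmod a)\<^sup>2 + 2 * (cmod b)\<^sup>2"
proof -
  have "(cmod (a + b))\<^sup>2 \<le> (cmod a + cmod b)\<^sup>2"
    by (intro power_mono norm_triangle_ineq) auto
  also have "\<dots> \<le> 2 * (cmod a)\<^sup>2 + 2 * (cmod b)\<^sup>2"
    using zero_le_power2[of "cmod a - cmod b"] by (simp add: power2_eq_square algebra_simps)
  finally show ?thesis .
qed

lemma L2_add [intro]:
  assumes "f \<in> L2 M" "g \<in> L2 M" shows "(\<lambda>x. f x + g x) \<in> L2 M"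
proof (rule L2_I)
  have [measurable]: "f \<in> borel_measurable M" "g \<in> borel_measurable M"
    using assms by (auto simp: L2_def)
  show "(\<lambda>x. f x + g x) \<in> borel_measurable M" by measurable
  have "integrable M (\<lambda>x. 2 * (cmod (f x))\<^sup>2 + 2 * (cmod (g x))\<^sup>2)"
    using assms by (auto simp: L2_def)
  then show "integrable M (\<lambda>x. (cmod (f x + g x))\<^sup>2)"
    by (rule Bochner_Integration.integrable_bound) (auto simp: cmod_add_sq_le)
qed

lemma L2_diff [intro]:
  assumes "f \<in> L2 M" "g \<in> L2 M" shows "(\<lambda>x. f x - g x) \<in> L2 M"
  using L2_add[OF assms(1) L2_cmult[OF assms(2), of "-1"]] by simp

lemma L2_inner_integrable:
  assumes "f \<in> L2 M" "g \<in> L2 M" shows "integrable M (\<lambda>x. f x * cnj (g x))"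
proof -
  have [measurable]: "f \<in> borel_measurable M" "g \<in> borel_measurable M"
    using assms by (auto simp: L2_def)
  have "integrable M (\<lambda>x. (cmod (f x))\<^sup>2 + (cmod (g x))\<^sup>2)"
    using assms by (auto simp: L2_def)
  then show ?thesis
  proof (rule Bochner_Integration.integrable_bound)
    have "a * b \<le> a\<^sup>2 + b\<^sup>2" for a b :: real
      using zero_le_power2[of "a - b"] zero_le_power2[of a] zero_le_power2[of b]
      unfolding power2_diff by linarith
    then show "AE x in M. norm (f x * cnj (g x)) \<le> norm ((cmod (f x))\<^sup>2 + (cmod (g x))\<^sup>2)"
      by (auto simp: norm_mult)
  qed measurable
qed

lemma L2_inner_add_left:
  "f \<in> L2 M \<Longrightarrow> g \<in> L2 M \<Longrightarrow> h \<in> L2 M \<Longrightarrow>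
    L2_inner M (\<lambda>x. f x + g x) h = L2_inner M f h + L2_inner M g h"
  unfolding L2_inner_def by (simp add: distrib_right L2_inner_integrable)

lemma L2_inner_cmult_left: "L2_inner M (\<lambda>x. c * f x) g = c * L2_inner M f g"
  unfolding L2_inner_def by (simp add: mult.assoc)

lemma L2_inner_commute: "L2_inner M g f = cnj (L2_inner M f g)"
  unfolding L2_inner_def by (subst Bochner_Integration.integral_cnj[symmetric]) (simp add: mult.commute)

lemma L2_inner_cmult_right: "L2_inner M f (\<lambda>x. c * g x) = cnj c * L2_inner M f g"
  unfolding L2_inner_def by (simp add: mult.left_commute)

lemma L2_inner_add_right:
  "f \<in> L2 M \<Longrightarrow> g \<in> L2 M \<Longrightarrow> h \<in> L2 M \<Longrightarrow>
    L2_inner M h (\<lambda>x. f x + g x) = L2_inner M h f + L2_inner M h g"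
  unfolding L2_inner_def by (simp add: distrib_left L2_inner_integrable)

lemma L2_inner_cong_AE:
  assumes "AE x in M. f x = f' x" "AE x in M. g x = g' x"
    "f \<in> borel_measurable M" "f' \<in> borel_measurable M"
    "g \<in> borel_measurable M" "g' \<in> borel_measurable M"
  shows "L2_inner M f g = L2_inner M f' g'"
  unfolding L2_inner_def using assms by (intro integral_cong_AE) auto

lemma L2_norm_cong_AE:
  assumes "AE x in M. f x = g x" "f \<in> borel_measurable M" "g \<in> borel_measurable M"
  shows "L2_norm M f = L2_norm M g"
  unfolding L2_norm_def using assms by (intro arg_cong[where f=sqrt] integral_cong_AE) auto

lemma L2_norm_nonneg [simp]: "0 \<le> L2_norm M f"
  unfolding L2_norm_def by simp

lemma L2_norm_sq: "(L2_norm M f)\<^sup>2 = (\<integral>x. (cmod (f x))\<^sup>2 \<partial>M)"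
  unfolding L2_norm_def by simp

lemma L2_inner_self: "L2_inner M f f = complex_of_real ((L2_norm M f)\<^sup>2)"
  unfolding L2_inner_def L2_norm_sq
  by (subst integral_complex_of_real[symmetric]) (simp add: complex_norm_square[symmetric] del: of_real_power)

lemma L2_norm_eq_0_iff:
  assumes "f \<in> L2 M" shows "L2_norm M f = 0 \<longleftrightarrow> (AE x in M. f x = 0)"
proof -
  have "L2_norm M f = 0 \<longleftrightarrow> (\<integral>x. (cmod (f x))\<^sup>2 \<partial>M) = 0"
    unfolding L2_norm_def by simp
  also have "\<dots> \<longleftrightarrow> (AE x in M. f x = 0)"
    by (subst integral_nonneg_eq_0_iff_AE[OF L2_integrable[OF assms]]) auto
  finally show ?thesis .
qed

lemma L2_norm_cmult: "L2_norm M (\<lambda>x. c * f x) = cmod c * L2_norm M f"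
  unfolding L2_norm_def norm_mult power_mult_distrib integral_mult_right_zero real_sqrt_mult by simp

text \<open>Symmetric and real-bilinear, so quadratic expansions are free of conjugates; norms are
  unaffected because \<open>L2_inner M f f\<close> is real.\<close>

definition L2_rinner :: "'a measure \<Rightarrow> ('a \<Rightarrow> complex) \<Rightarrow> ('a \<Rightarrow> complex) \<Rightarrow> real" where
  "L2_rinner M f g = Re (L2_inner M f g)"

lemma L2_rinner_commute: "L2_rinner M f g = L2_rinner M g f"
  unfolding L2_rinner_def L2_inner_commute[of M g f] by simp

lemma L2_rinner_add_left:
  "f \<in> L2 M \<Longrightarrow> g \<in> L2 M \<Longrightarrow> h \<in> L2 M \<Longrightarrow>
    L2_rinner M (\<lambda>x. f x + g x) h = L2_rinner M f h + L2_rinner M g h"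
  unfolding L2_rinner_def by (simp add: L2_inner_add_left)

lemma L2_rinner_scale_left:
  "L2_rinner M (\<lambda>x. complex_of_real c * f x) g = c * L2_rinner M f g"
  unfolding L2_rinner_def by (simp add: L2_inner_cmult_left)

lemma L2_rinner_diff_left:
  assumes "f \<in> L2 M" "g \<in> L2 M" "h \<in> L2 M"
  shows "L2_rinner M (\<lambda>x. f x - g x) h = L2_rinner M f h - L2_rinner M g h"
  using L2_rinner_add_left[OF assms(1) L2_cmult[OF assms(2), of "complex_of_real (-1)"] assms(3)]
    L2_rinner_scale_left[of M "-1" g h] by simp

lemma L2_rinner_add_right:
  "f \<in> L2 M \<Longrightarrow> g \<in> L2 M \<Longrightarrow> h \<in> L2 M \<Longrightarrow>
    L2_rinner M h (\<lambda>x. f x + g x) = L2_rinner M h f + L2_rinner M h g"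
  by (simp add: L2_rinner_commute[of M h] L2_rinner_add_left)

lemma L2_rinner_diff_right:
  "f \<in> L2 M \<Longrightarrow> g \<in> L2 M \<Longrightarrow> h \<in> L2 M \<Longrightarrow>
    L2_rinner M h (\<lambda>x. f x - g x) = L2_rinner M h f - L2_rinner M h g"
  by (simp add: L2_rinner_commute[of M h] L2_rinner_diff_left)

lemma L2_rinner_scale_right:
  "L2_rinner M f (\<lambda>x. complex_of_real c * g x) = c * L2_rinner M f g"
  by (simp only: L2_rinner_commute[of M f] L2_rinner_scale_left)

lemma L2_rinner_self: "L2_rinner M f f = (L2_norm M f)\<^sup>2"
  unfolding L2_rinner_def L2_inner_self by simp

lemma L2_rinner_self_nonneg: "0 \<le> L2_rinner M f f"
  by (simp add: L2_rinner_self)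

text \<open>Nonnegativity of the norm of \<open>s f - t g\<close> for all real \<open>s\<close> and
  \<open>t\<close>; two parameters keep \<open>?b\<close> out of denominators.\<close>

lemma L2_rinner_Cauchy_Schwarz:
  assumes f: "f \<in> L2 M" and g: "g \<in> L2 M"
  shows "\<bar>L2_rinner M f g\<bar> \<le> L2_norm M f * L2_norm M g"
proof -
  let ?a = "L2_rinner M f f" and ?b = "L2_rinner M g g" and ?c = "L2_rinner M f g"
  have expand: "0 \<le> s\<^sup>2 * ?a - 2 * s * t * ?c + t\<^sup>2 * ?b" for s t :: real
  proof -
    let ?h = "\<lambda>x. complex_of_real s * f x - complex_of_real t * g x"
    have "0 \<le> L2_rinner M ?h ?h" by (rule L2_rinner_self_nonneg)
    also have "\<dots> = s\<^sup>2 * ?a - 2 * s * t * ?c + t\<^sup>2 * ?b"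
      using f g L2_rinner_commute[of M g f]
      by (simp add: L2_rinner_diff_left L2_rinner_diff_right L2_diff L2_cmult
          L2_rinner_scale_left L2_rinner_scale_right power2_eq_square algebra_simps)
    finally show ?thesis .
  qed
  have "?c\<^sup>2 \<le> ?a * ?b"
  proof (cases "?b = 0")
    case True
    have "?c = 0"
    proof (rule ccontr)
      assume "?c \<noteq> 0"
      \<comment> \<open>With \<open>?b = 0\<close> this choice of \<open>t\<close> gives the
        quadratic the value \<open>-1\<close>.\<close>
      with expand[of 1 "(?a + 1) / (2 * ?c)"] True show False by (simp add: field_simps)
    qed
    with True show ?thesis by simp
  next
    case False
    then have "?b > 0" using L2_rinner_self_nonneg[of M g] by linarith
    \<comment> \<open>For \<open>s = ?b\<close> and \<open>t = ?c\<close> the quadratic is exactly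
      this product.\<close>
    moreover have "0 \<le> ?b * (?a * ?b - ?c\<^sup>2)"
      using expand[of ?b ?c] by (simp add: power2_eq_square algebra_simps)
    ultimately show ?thesis by (simp add: zero_le_mult_iff)
  qed
  then have "\<bar>?c\<bar>\<^sup>2 \<le> (L2_norm M f * L2_norm M g)\<^sup>2"
    by (simp add: L2_rinner_self power_mult_distrib)
  then show ?thesis by (rule power2_le_imp_le) simp
qed

lemma L2_norm_triangle:
  assumes "f \<in> L2 M" "g \<in> L2 M"
  shows "L2_norm M (\<lambda>x. f x + g x) \<le> L2_norm M f + L2_norm M g"
proof -
  have "(L2_norm M (\<lambda>x. f x + g x))\<^sup>2
      = (L2_norm M f)\<^sup>2 + 2 * L2_rinner M f g + (L2_norm M g)\<^sup>2"
    using assms L2_rinner_commute[of M g f]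
    by (simp add: L2_rinner_self[symmetric] L2_rinner_add_left L2_rinner_add_right L2_add)
  also have "\<dots> \<le> (L2_norm M f + L2_norm M g)\<^sup>2"
    using L2_rinner_Cauchy_Schwarz[OF assms] by (simp add: power2_eq_square algebra_simps)
  finally show ?thesis by (rule power2_le_imp_le) simp
qed

text \<open>The parallelogram identity, with the norm of the sum discarded.\<close>

lemma L2_norm_sq_diff_le:
  assumes "f \<in> L2 M" "g \<in> L2 M"
  shows "(L2_norm M (\<lambda>x. f x - g x))\<^sup>2 \<le> 2 * (L2_norm M f)\<^sup>2 + 2 * (L2_norm M g)\<^sup>2"
proof -
  have "0 \<le> L2_rinner M (\<lambda>x. f x + g x) (\<lambda>x. f x + g x)" by (rule L2_rinner_self_nonneg)
  then show ?thesis
    using assms L2_rinner_commute[of M g f]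
    by (simp add: L2_rinner_self[symmetric] L2_rinner_add_left L2_rinner_add_right L2_add
        L2_rinner_diff_left L2_rinner_diff_right L2_diff)
qed

section \<open>Bounded operators acting on representatives\<close>

lemma L2_bounded_opD:
  assumes "L2_bounded_op M T"
  shows "\<And>f. f \<in> L2 M \<Longrightarrow> T f \<in> L2 M"
    "\<And>f g. f \<in> L2 M \<Longrightarrow> g \<in> L2 M \<Longrightarrow> AE x in M. T (\<lambda>y. f y + g y) x = T f x + T g x"
    "\<And>c f. f \<in> L2 M \<Longrightarrow> AE x in M. T (\<lambda>y. c * f y) x = c * T f x"
  using assms unfolding L2_bounded_op_def by blast+

text \<open>The bound is made strictly positive because later arguments divide by it.\<close>

lemma L2_bounded_op_bound:
  assumes "L2_bounded_op M T"
  obtains C where "C > 0" "\<And>f. f \<in> L2 M \<Longrightarrow> L2_norm M (T f) \<le> C * L2_norm M f"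
proof -
  obtain C where C: "\<And>f. f \<in> L2 M \<Longrightarrow> L2_norm M (T f) \<le> C * L2_norm M f"
    using assms unfolding L2_bounded_op_def by blast
  have "L2_norm M (T f) \<le> max C 1 * L2_norm M f" if "f \<in> L2 M" for f
    using C[OF that] mult_right_mono[of C "max C 1" "L2_norm M f"] by simp
  then show thesis by (intro that[of "max C 1"]) auto
qed

lemma L2_bounded_op_diff:
  assumes T: "L2_bounded_op M T" and f: "f \<in> L2 M" and g: "g \<in> L2 M"
  shows "AE x in M. T (\<lambda>y. f y - g y) x = T f x - T g x"
  using L2_bounded_opD(2)[OF T f L2_cmult[OF g, of "-1"]] L2_bounded_opD(3)[OF T g, of "-1"] by auto

lemma L2_bounded_op_zero:
  assumes T: "L2_bounded_op M T" and f: "f \<in> L2 M" and 0: "AE x in M. f x = 0"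
  shows "AE x in M. T f x = 0"
proof -
  obtain C where "L2_norm M (T f) \<le> C * L2_norm M f"
    using L2_bounded_op_bound[OF T] f by metis
  then have "L2_norm M (T f) = 0"
    using 0 L2_norm_eq_0_iff[OF f] by (intro antisym) auto
  then show ?thesis using L2_norm_eq_0_iff[OF L2_bounded_opD(1)[OF T f]] by simp
qed

lemma L2_bounded_op_cong_AE:
  assumes T: "L2_bounded_op M T" and f: "f \<in> L2 M" and g: "g \<in> L2 M"
    and eq: "AE x in M. f x = g x"
  shows "AE x in M. T f x = T g x"
proof -
  have "AE x in M. T (\<lambda>y. f y - g y) x = 0"
    using eq by (intro L2_bounded_op_zero[OF T] L2_diff f g) auto
  with L2_bounded_op_diff[OF T f g] show ?thesis by auto
qed

section \<open>Positive operators\<close>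

lemma L2_positive_bounded: "L2_positive M P \<Longrightarrow> L2_bounded_op M P"
  by (simp add: L2_positive_def)

lemma L2_positive_rinner:
  assumes "L2_positive M P" "f \<in> L2 M" shows "0 \<le> L2_rinner M (P f) f"
  using assms by (auto simp: L2_positive_def L2_rinner_def nonneg_Reals_def)

text \<open>Polarisation with \<open>f + \<i> g\<close>: this is where the complex scalars are needed.\<close>

lemma L2_positive_selfadjoint:
  assumes P: "L2_positive M P" and f: "f \<in> L2 M" and g: "g \<in> L2 M"
  shows "L2_rinner M (P f) g = L2_rinner M f (P g)"
proof -
  note B = L2_positive_bounded[OF P]
  have real: "Im (L2_inner M (P h) h) = 0" if "h \<in> L2 M" for h
    using P that by (force simp: L2_positive_def nonneg_Reals_def)
  let ?ig = "\<lambda>x. \<i> * g x"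
  let ?h = "\<lambda>x. f x + ?ig x"
  have ig: "?ig \<in> L2 M" and h: "?h \<in> L2 M" using f g by auto
  note m = L2_bounded_opD(1)[OF B]
  have "AE x in M. P ?h x = P f x + \<i> * P g x"
    using L2_bounded_opD(2)[OF B f ig] L2_bounded_opD(3)[OF B g, of \<i>] by auto
  then have "L2_inner M (P ?h) ?h = L2_inner M (\<lambda>x. P f x + \<i> * P g x) ?h"
    using f g h m by (intro L2_inner_cong_AE) (auto intro!: L2_measurable)
  also have "\<dots> = L2_inner M (P f) f + L2_inner M (P g) g
      + \<i> * (L2_inner M (P g) f - L2_inner M (P f) g)"
    using f g ig h m L2_cmult[OF m[OF g], of \<i>]
    by (simp add: L2_inner_add_left L2_inner_add_right L2_add L2_inner_cmult_left
        L2_inner_cmult_right algebra_simps)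
  finally have "Re (L2_inner M (P g) f) = Re (L2_inner M (P f) g)"
    using real[OF h] real[OF f] real[OF g] by simp
  then show ?thesis
    using L2_rinner_commute[of M f "P g"] by (simp add: L2_rinner_def)
qed

text \<open>Obtained from positivity at \<open>f - P f / C\<close>.\<close>

lemma L2_positive_norm_bound:
  assumes P: "L2_positive M P" and C: "C > 0"
    and bound: "\<And>f. f \<in> L2 M \<Longrightarrow> L2_norm M (P f) \<le> C * L2_norm M f" and f: "f \<in> L2 M"
  shows "(L2_norm M (P f))\<^sup>2 \<le> C * L2_rinner M (P f) f"
proof -
  note B = L2_positive_bounded[OF P]
  note m = L2_bounded_opD(1)[OF B]
  let ?t = "1 / C"
  let ?tPf = "\<lambda>x. complex_of_real ?t * P f x"
  let ?h = "\<lambda>x. f x - ?tPf x"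
  have tPf: "?tPf \<in> L2 M" using m[OF f] by (rule L2_cmult)
  have h: "?h \<in> L2 M" using f tPf by (rule L2_diff)
  have s: "L2_rinner M (P a) b = L2_rinner M a (P b)" if "a \<in> L2 M" "b \<in> L2 M" for a b
    using L2_positive_selfadjoint[OF P that] .
  have *: "L2_rinner M ?h (P k) = L2_rinner M f (P k) - ?t * L2_rinner M (P f) (P k)"
    if "k \<in> L2 M" for k
    using that f m tPf L2_rinner_scale_left[of M ?t "P f"] by (simp add: L2_rinner_diff_left)
  have "0 \<le> L2_rinner M (P ?h) ?h" by (rule L2_positive_rinner[OF P h])
  also have "\<dots> = L2_rinner M (P ?h) f - ?t * L2_rinner M (P ?h) (P f)"
    using m h f tPf L2_rinner_scale_right[of M "P ?h" ?t "P f"] by (simp add: L2_rinner_diff_right)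
  also have "\<dots> = L2_rinner M ?h (P f) - ?t * L2_rinner M ?h (P (P f))"
    using s h f m by simp
  also have "\<dots> = L2_rinner M f (P f) - ?t * L2_rinner M (P f) (P f)
       - ?t * (L2_rinner M f (P (P f)) - ?t * L2_rinner M (P f) (P (P f)))"
    using * f m by simp
  also have "L2_rinner M f (P (P f)) = (L2_norm M (P f))\<^sup>2"
    using s[of f "P f"] f m by (simp add: L2_rinner_self)
  also have "L2_rinner M f (P f) = L2_rinner M (P f) f" by (rule L2_rinner_commute)
  finally have 1: "0 \<le> L2_rinner M (P f) f - 2 * ?t * (L2_norm M (P f))\<^sup>2
      + ?t\<^sup>2 * L2_rinner M (P f) (P (P f))"
    by (simp add: L2_rinner_self power2_eq_square algebra_simps)
  \<comment> \<open>The bound applied to the vector \<open>P f\<close> shows that the quadratic term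
    of the expansion cancels at most half of the negative linear term.\<close>
  have "L2_rinner M (P f) (P (P f)) \<le> L2_norm M (P f) * L2_norm M (P (P f))"
    using L2_rinner_Cauchy_Schwarz[OF m m, of f "P f"] f m by fastforce
  also have "\<dots> \<le> L2_norm M (P f) * (C * L2_norm M (P f))"
    by (intro mult_left_mono bound m f) simp
  also have "\<dots> = C * (L2_norm M (P f))\<^sup>2" by (simp add: power2_eq_square)
  finally have "?t\<^sup>2 * L2_rinner M (P f) (P (P f)) \<le> ?t\<^sup>2 * (C * (L2_norm M (P f))\<^sup>2)"
    by (intro mult_left_mono) auto
  also have "\<dots> = ?t * (L2_norm M (P f))\<^sup>2" using C by (simp add: power2_eq_square)
  finally have "?t * (L2_norm M (P f))\<^sup>2 \<le> L2_rinner M (P f) f" using 1 by simp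
  then show ?thesis using C by (simp add: field_simps)
qed

subsection \<open>Uniqueness of square roots and polar decompositions\<close>

lemma L2_op_eq_sym: "L2_op_eq M S T \<Longrightarrow> L2_op_eq M T S"
  unfolding L2_op_eq_def by (blast intro: AE_symmetric)

lemma L2_op_eqD: "L2_op_eq M S T \<Longrightarrow> f \<in> L2 M \<Longrightarrow> AE x in M. S f x = T f x"
  by (simp add: L2_op_eq_def)

lemma L2_op_eq_trans: "L2_op_eq M R S \<Longrightarrow> L2_op_eq M S T \<Longrightarrow> L2_op_eq M R T"
  unfolding L2_op_eq_def
proof
  fix f assume *: "\<forall>f\<in>L2 M. AE x in M. R f x = S f x" "\<forall>f\<in>L2 M. AE x in M. S f x = T f x"
    and f: "f \<in> L2 M"
  show "AE x in M. R f x = T f x"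
    using bspec[OF *(1) f] bspec[OF *(2) f] by eventually_elim simp
qed

text \<open>With \<open>X = P - Q\<close> and \<open>Y = P + Q\<close>, the hypothesis \<open>P\<^sup>2 = Q\<^sup>2\<close> reads \<open>X Y + Y X = 0\<close>, so
  \<open>\<langle>X\<^sup>2 v, Y v\<rangle> = - \<langle>Y X v, X v\<rangle> \<le> 0\<close>.  If \<open>s = \<parallel>X\<parallel>\<^sup>2 > 0\<close>, then an approximate eigenvector \<open>v\<close> of
  \<open>X\<^sup>2\<close> for \<open>s\<close> has small \<open>\<langle>v, Y v\<rangle>\<close>, hence small \<open>P v\<close>, \<open>Q v\<close> and \<open>X v\<close>, a contradiction.  This
  avoids the functional calculus.\<close>

lemma L2_positive_square_root_unique:
  assumes P: "L2_positive M P" and Q: "L2_positive M Q"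
    and sq: "\<And>f g. f \<in> L2 M \<Longrightarrow> g \<in> L2 M \<Longrightarrow> L2_rinner M (P (P f)) g = L2_rinner M (Q (Q f)) g"
  shows "L2_op_eq M P Q"
proof -
  let ?r = "L2_rinner M" and ?n = "L2_norm M"
  note mP = L2_bounded_opD(1)[OF L2_positive_bounded[OF P]]
  note mQ = L2_bounded_opD(1)[OF L2_positive_bounded[OF Q]]
  note sP = L2_positive_selfadjoint[OF P] and sQ = L2_positive_selfadjoint[OF Q]
  obtain C1 where C1: "C1 > 0" "\<And>f. f \<in> L2 M \<Longrightarrow> ?n (P f) \<le> C1 * ?n f"
    using L2_bounded_op_bound[OF L2_positive_bounded[OF P]] by metis
  obtain C2 where C2: "C2 > 0" "\<And>f. f \<in> L2 M \<Longrightarrow> ?n (Q f) \<le> C2 * ?n f"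
    using L2_bounded_op_bound[OF L2_positive_bounded[OF Q]] by metis
  define C where "C = C1 + C2"
  have "C > 0" using C1 C2 by (simp add: C_def)
  have CP: "?n (P f) \<le> C * ?n f" and CQ: "?n (Q f) \<le> C * ?n f" if "f \<in> L2 M" for f
    using C1(2)[OF that] C2(2)[OF that] C1(1) C2(1)
      mult_right_mono[of C1 C "?n f"] mult_right_mono[of C2 C "?n f"]
    by (auto simp: C_def)
  define X where "X = (\<lambda>f x. P f x - Q f x)"
  define Y where "Y = (\<lambda>f x. P f x + Q f x)"
  have mX: "X f \<in> L2 M" and mY: "Y f \<in> L2 M" if "f \<in> L2 M" for f
    using mP[OF that] mQ[OF that] by (auto simp: X_def Y_def)
  have rX: "?r (X f) g = ?r (P f) g - ?r (Q f) g" and rY: "?r (Y f) g = ?r (P f) g + ?r (Q f) g"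
    and rX': "?r g (X f) = ?r g (P f) - ?r g (Q f)" and rY': "?r g (Y f) = ?r g (P f) + ?r g (Q f)"
    if "f \<in> L2 M" "g \<in> L2 M" for f g
    using that mP mQ unfolding X_def Y_def
    by (simp_all add: L2_rinner_diff_left L2_rinner_add_left L2_rinner_diff_right L2_rinner_add_right)
  have sX: "?r (X f) g = ?r f (X g)" if "f \<in> L2 M" "g \<in> L2 M" for f g
    using that sP sQ by (simp add: rX rX')
  have neg: "?r (X (X v)) (Y v) \<le> 0" if v: "v \<in> L2 M" for v
  proof -
    note mem = mP[OF v] mQ[OF v] mP[OF mP[OF v]] mP[OF mQ[OF v]] mQ[OF mP[OF v]] mQ[OF mQ[OF v]]
      mX[OF v] mY[OF v] mP[OF mX[OF v]] mQ[OF mX[OF v]]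
    \<comment> \<open>\<open>P\<^sup>2 = Q\<^sup>2\<close> enters only through these two pairings;
      self-adjointness brings \<open>\<langle>P Q v, P v\<rangle>\<close> and
      \<open>\<langle>Q P v, Q v\<rangle>\<close> into the same form.\<close>
    have sq1: "?r (P (P v)) (P v) = ?r (Q (Q v)) (P v)" by (rule sq) (use v mem in auto)
    have sq2: "?r (P (P v)) (Q v) = ?r (Q (Q v)) (Q v)" by (rule sq) (use v mem in auto)
    have PX: "?r (P (X v)) z = ?r (P (P v)) z - ?r (P (Q v)) z" if "z \<in> L2 M" for z
      using that v mem mP[OF that] by (simp add: sP rX)
    have QX: "?r (Q (X v)) z = ?r (Q (P v)) z - ?r (Q (Q v)) z" if "z \<in> L2 M" for z
      using that v mem mQ[OF that] by (simp add: sQ rX)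
    have "?r (P (Q v)) (P v) = ?r (P (P v)) (Q v)"
      using sP[of "Q v" "P v"] mem L2_rinner_commute by metis
    moreover have "?r (Q (P v)) (Q v) = ?r (Q (Q v)) (P v)"
      using sQ[of "P v" "Q v"] mem L2_rinner_commute by metis
    ultimately have "?r (X (X v)) (Y v) = - ?r (Y (X v)) (X v)"
      using v mem sq1 sq2 by (simp add: rX rY rX' rY' PX QX)
    moreover have "0 \<le> ?r (Y (X v)) (X v)"
      using L2_positive_rinner[OF P mX[OF v]] L2_positive_rinner[OF Q mX[OF v]] v mem
      by (simp add: rY)
    ultimately show ?thesis by simp
  qed
  \<comment> \<open>Converts smallness of \<open>\<langle>v, Y v\<rangle>\<close> into smallness of
    \<open>X v\<close>, by the norm bound for positive operators applied to \<open>P\<close> and to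
    \<open>Q\<close>.\<close>
  have Xle: "?r (X v) (X v) \<le> 2 * C * ?r v (Y v)" if v: "v \<in> L2 M" for v
  proof -
    have "?r (X v) (X v) \<le> 2 * (?n (P v))\<^sup>2 + 2 * (?n (Q v))\<^sup>2"
      unfolding L2_rinner_self unfolding X_def by (rule L2_norm_sq_diff_le[OF mP[OF v] mQ[OF v]])
    also have "\<dots> \<le> 2 * (C * ?r (P v) v) + 2 * (C * ?r (Q v) v)"
      using L2_positive_norm_bound[OF P \<open>C > 0\<close> CP v] L2_positive_norm_bound[OF Q \<open>C > 0\<close> CQ v]
      by simp
    also have "\<dots> = 2 * C * ?r v (Y v)"
      using v L2_rinner_commute[of M v "P v"] L2_rinner_commute[of M v "Q v"]
      by (simp add: rY' algebra_simps)
    finally show ?thesis .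
  qed
  have Yn: "?n (Y v) \<le> 2 * C * ?n v" if v: "v \<in> L2 M" for v
    using L2_norm_triangle[OF mP[OF v] mQ[OF v]] CP[OF v] CQ[OF v] by (simp add: Y_def)
  \<comment> \<open>The infimum of \<open>S\<close> is the squared operator norm of
    \<open>X\<close>. The condition \<open>0 \<le> k\<close> keeps \<open>S\<close> bounded below
    even if every element of \<open>L2 M\<close> has norm zero.\<close>
  define S where "S = {k. 0 \<le> k \<and> (\<forall>v\<in>L2 M. ?r (X v) (X v) \<le> k * ?r v v)}"
  define s where "s = Inf S"
  have bdd: "bdd_below S" by (rule bdd_belowI[of _ 0]) (simp add: S_def)
  have "4 * C * C \<in> S"
  proof -
    have "?r (X v) (X v) \<le> 4 * C * C * ?r v v" if v: "v \<in> L2 M" for v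
    proof -
      have "?r v (Y v) \<le> ?n v * ?n (Y v)"
        using L2_rinner_Cauchy_Schwarz[OF v mY[OF v]] by linarith
      also have "\<dots> \<le> ?n v * (2 * C * ?n v)" by (intro mult_left_mono Yn v) auto
      finally have "2 * C * ?r v (Y v) \<le> 2 * C * (?n v * (2 * C * ?n v))"
        using \<open>C > 0\<close> by (intro mult_left_mono) auto
      also have "\<dots> = 4 * C * C * ?r v v"
        by (simp add: L2_rinner_self power2_eq_square)
      finally show ?thesis using Xle[OF v] by linarith
    qed
    with \<open>C > 0\<close> show ?thesis by (auto simp: S_def)
  qed
  then have "S \<noteq> {}" by auto
  have "s \<ge> 0" unfolding s_def by (rule cInf_greatest[OF \<open>S \<noteq> {}\<close>]) (simp add: S_def)
  have sS: "?r (X v) (X v) \<le> s * ?r v v" if v: "v \<in> L2 M" for v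
  proof (cases "?r v v = 0")
    case True
    then show ?thesis using \<open>4 * C * C \<in> S\<close> v by (force simp: S_def)
  next
    case False
    then have pos: "?r v v > 0" using L2_rinner_self_nonneg[of M v] by linarith
    have "?r (X v) (X v) / ?r v v \<le> s"
      unfolding s_def using pos v
      by (intro cInf_greatest[OF \<open>S \<noteq> {}\<close>]) (auto simp: S_def pos_divide_le_eq)
    with pos show ?thesis by (simp add: pos_divide_le_eq)
  qed
  have "s = 0"
  proof (rule ccontr)
    assume "s \<noteq> 0"
    with \<open>s \<ge> 0\<close> have "s > 0" by simp
    define B where "B = 4 * C * C"
    have est: "s * (1 - e) \<le> B * sqrt e" if e: "0 < e" "e < 1" for e
    proof -
      \<comment> \<open>Since \<open>e < 1\<close>, the number \<open>s * (1 - e)\<close> is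
        nonnegative, so the only way for it to miss \<open>S\<close> is a vector \<open>v\<close> on
        which \<open>X\<close> nearly attains its norm.\<close>
      have "s * (1 - e) \<notin> S"
      proof
        assume "s * (1 - e) \<in> S"
        then have "s \<le> s * (1 - e)" unfolding s_def by (rule cInf_lower[OF _ bdd])
        with mult_pos_pos[OF \<open>s > 0\<close> e(1)] show False by (simp add: algebra_simps)
      qed
      with \<open>s > 0\<close> e obtain v where v: "v \<in> L2 M" and big: "s * (1 - e) * ?r v v < ?r (X v) (X v)"
        by (auto simp: S_def not_le)
      define m where "m = ?r v v"
      have "m \<noteq> 0" using big sS[OF v] by (auto simp: m_def)
      then have m: "m > 0" using L2_rinner_self_nonneg[of M v] by (simp add: m_def)
      note XX = mX[OF mX[OF v]]
      let ?sv = "\<lambda>x. complex_of_real s * v x"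
      let ?D = "\<lambda>x. X (X v) x - ?sv x"
      have sv: "?sv \<in> L2 M" using v by (rule L2_cmult)
      have D: "?D \<in> L2 M" by (rule L2_diff[OF XX sv])
      \<comment> \<open>\<open>?D\<close> measures how far \<open>v\<close> is from an eigenvector
        of \<open>X\<^sup>2\<close>. The bound \<open>sS\<close> at \<open>X v\<close> leaves
        \<open>s * (s * m - ?r (X v) (X v))\<close>, and the choice of \<open>v\<close> makes this
        at most \<open>s\<^sup>2 * e * m\<close>.\<close>
      have "?r ?D ?D = ?r (X (X v)) (X (X v)) - 2 * s * ?r (X (X v)) v + s\<^sup>2 * m"
        using XX sv v D L2_rinner_commute[of M v "X (X v)"]
        by (simp add: L2_rinner_diff_left L2_rinner_diff_right L2_rinner_scale_left
            L2_rinner_scale_right m_def power2_eq_square algebra_simps)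
      also have "?r (X (X v)) v = ?r (X v) (X v)"
        using sX[OF mX[OF v] v] by simp
      also have "?r (X (X v)) (X (X v)) - 2 * s * ?r (X v) (X v) + s\<^sup>2 * m
          \<le> s * (s * m - ?r (X v) (X v))"
        using sS[OF mX[OF v]] by (simp add: power2_eq_square algebra_simps)
      also have "\<dots> \<le> s * (s * e * m)"
        using big \<open>s > 0\<close> by (intro mult_left_mono) (auto simp: m_def algebra_simps)
      finally have D2: "(?n ?D)\<^sup>2 \<le> s\<^sup>2 * e * m"
        by (simp add: L2_rinner_self power2_eq_square algebra_simps)
      have nv: "?n v = sqrt m"
        using L2_rinner_self[of M v] by (simp add: m_def real_sqrt_unique[symmetric])
      have "?n ?D \<le> sqrt (s\<^sup>2 * e * m)" using D2 by (rule real_le_rsqrt)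
      also have "\<dots> = s * sqrt e * sqrt m" using \<open>s > 0\<close> by (simp add: real_sqrt_mult)
      finally have nD: "?n ?D \<le> s * sqrt e * sqrt m" .
      \<comment> \<open>By \<open>neg\<close> the first term on the right is nonpositive, so
        \<open>s \<langle>v, Y v\<rangle>\<close> is dominated by a pairing with the short vector
        \<open>?D\<close>.\<close>
      have "?r ?D (Y v) = ?r (X (X v)) (Y v) - s * ?r v (Y v)"
        using XX sv mY[OF v] L2_rinner_scale_left[of M s v] by (simp add: L2_rinner_diff_left)
      with neg[OF v] have "s * ?r v (Y v) \<le> \<bar>?r ?D (Y v)\<bar>" by linarith
      also have "\<dots> \<le> ?n ?D * ?n (Y v)" by (rule L2_rinner_Cauchy_Schwarz[OF D mY[OF v]])
      also have "\<dots> \<le> (s * sqrt e * sqrt m) * (2 * C * sqrt m)"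
        using nD Yn[OF v] \<open>s > 0\<close> e m by (intro mult_mono) (auto simp: nv)
      also have "\<dots> = s * (2 * C * sqrt e * (sqrt m * sqrt m))" by (simp only: mult_ac)
      also have "\<dots> = s * (2 * C * sqrt e * m)" using m by simp
      finally have "?r v (Y v) \<le> 2 * C * sqrt e * m" using \<open>s > 0\<close> by simp
      then have "2 * C * ?r v (Y v) \<le> 2 * C * (2 * C * sqrt e * m)"
        using \<open>C > 0\<close> by (intro mult_left_mono) auto
      with big Xle[OF v] have "s * (1 - e) * m \<le> B * sqrt e * m"
        by (simp add: m_def[symmetric] B_def algebra_simps)
      with m show ?thesis by simp
    qed
    \<comment> \<open>Letting \<open>e\<close> decrease to 0 leaves
      \<open>s \<le> 0\<close>.\<close>
    have "s * (1 - 0) \<le> B * sqrt 0"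
    proof (rule tendsto_le[where F="at_right 0"])
      show "((\<lambda>e. B * sqrt e) \<longlongrightarrow> B * sqrt 0) (at_right 0)"
        by (intro tendsto_intros)
      show "((\<lambda>e. s * (1 - e)) \<longlongrightarrow> s * (1 - 0)) (at_right 0)"
        by (intro tendsto_intros)
      show "\<forall>\<^sub>F e in at_right 0. s * (1 - e) \<le> B * sqrt e"
        using est by (auto simp: eventually_at_right[of 0 1] intro!: exI[of _ 1])
    qed simp
    with \<open>s > 0\<close> show False by simp
  qed
  show ?thesis unfolding L2_op_eq_def
  proof
    fix f assume f: "f \<in> L2 M"
    have "?n (X f) = 0"
      using sS[OF f] \<open>s = 0\<close> by (simp add: L2_rinner_self)
    then show "AE x in M. P f x = Q f x"
      using L2_norm_eq_0_iff[OF mX[OF f]] by (auto simp: X_def)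
  qed
qed

lemma L2_abs_op_positive: "L2_abs_op M T P \<Longrightarrow> L2_positive M P"
  by (auto simp: L2_abs_op_def L2_pos_sqrt_def)

text \<open>Eliminates the existentially quantified adjoint: the right-hand side involves
  \<open>T\<close> alone, so two absolute values of \<open>T\<close> obtained from different
  adjoints can be compared.\<close>

lemma L2_abs_op_square:
  assumes T: "L2_bounded_op M T" and "L2_abs_op M T P" and f: "f \<in> L2 M" and g: "g \<in> L2 M"
  shows "L2_rinner M (P (P f)) g = L2_rinner M (T f) (T g)"
proof -
  obtain T' where T': "L2_adjoint M T T'" and P: "L2_positive M P"
    and eq: "L2_op_eq M (P \<circ> P) (T' \<circ> T)"
    using assms(2) by (auto simp: L2_abs_op_def L2_pos_sqrt_def)
  note m = L2_bounded_opD(1)[OF L2_positive_bounded[OF P]] L2_bounded_opD(1)[OF T]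
  have B': "L2_bounded_op M T'" using T' by (simp add: L2_adjoint_def)
  have "AE x in M. P (P f) x = T' (T f) x" using eq f by (simp add: L2_op_eq_def)
  then have "L2_inner M g (P (P f)) = L2_inner M g (T' (T f))"
    using f g m L2_bounded_opD(1)[OF B'] by (intro L2_inner_cong_AE) (auto intro!: L2_measurable)
  also have "\<dots> = L2_inner M (T g) (T f)" using T' f g m by (simp add: L2_adjoint_def)
  finally show ?thesis
    using L2_rinner_commute[of M g "P (P f)"] L2_rinner_commute[of M "T g" "T f"]
    by (simp add: L2_rinner_def)
qed

lemma L2_abs_op_unique:
  assumes "L2_bounded_op M T" "L2_abs_op M T P" "L2_abs_op M T Q"
  shows "L2_op_eq M P Q"
proof (rule L2_positive_square_root_unique)
  show "L2_positive M P" "L2_positive M Q" using assms by (auto intro: L2_abs_op_positive)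
  fix f g assume fg: "f \<in> L2 M" "g \<in> L2 M"
  show "L2_rinner M (P (P f)) g = L2_rinner M (Q (Q f)) g"
    unfolding L2_abs_op_square[OF assms(1,2) fg] L2_abs_op_square[OF assms(1,3) fg] ..
qed

text \<open>\<open>U'\<close> and \<open>U\<close> agree on the range of \<open>P\<close>, where
  \<open>T\<close> prescribes them, and both vanish on the kernel of \<open>P\<close>; boundedness
  of \<open>W = U' - U\<close> extends this to the closure. Density is a hypothesis so that it can
  be supplied by a concrete construction.\<close>

lemma L2_polar_decomp_unique:
  assumes d: "L2_polar_decomp M T U P" and d': "L2_polar_decomp M T U' P'"
    and dense: "\<And>f e. f \<in> L2 M \<Longrightarrow> 0 < e \<Longrightarrow>
      \<exists>g\<in>L2 M. \<exists>k\<in>L2_ker M P. L2_norm M (\<lambda>x. f x - (P g x + k x)) < e"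
  shows "L2_op_eq M U' U \<and> L2_op_eq M P' P"
proof -
  have T: "L2_bounded_op M T" and U: "L2_bounded_op M U" and U': "L2_bounded_op M U'"
    and P: "L2_bounded_op M P" and P': "L2_bounded_op M P'"
    using d d' L2_positive_bounded[OF L2_abs_op_positive]
    by (auto simp: L2_polar_decomp_def L2_partial_isometry_def)
  have PP': "L2_op_eq M P' P"
    using d d' by (intro L2_abs_op_unique[OF T]) (auto simp: L2_polar_decomp_def)
  obtain C where C: "C > 0" "\<And>f. f \<in> L2 M \<Longrightarrow> L2_norm M (U f) \<le> C * L2_norm M f"
    using L2_bounded_op_bound[OF U] by metis
  obtain C' where C': "C' > 0" "\<And>f. f \<in> L2 M \<Longrightarrow> L2_norm M (U' f) \<le> C' * L2_norm M f"
    using L2_bounded_op_bound[OF U'] by metis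
  have "AE x in M. U' f x = U f x" if f: "f \<in> L2 M" for f
  proof -
    define W where "W = (\<lambda>f x. U' f x - U f x)"
    have mW: "W h \<in> L2 M" if "h \<in> L2 M" for h
      unfolding W_def using that L2_bounded_opD(1)[OF U] L2_bounded_opD(1)[OF U'] by auto
    have nW: "L2_norm M (W h) \<le> (C' + C) * L2_norm M h" if "h \<in> L2 M" for h
    proof -
      have "L2_norm M (W h) \<le> L2_norm M (U' h) + L2_norm M (\<lambda>x. - 1 * U h x)"
        using L2_norm_triangle[OF L2_bounded_opD(1)[OF U' that]
            L2_cmult[OF L2_bounded_opD(1)[OF U that], of "-1"]] by (simp add: W_def)
      also have "\<dots> = L2_norm M (U' h) + L2_norm M (U h)" by (subst L2_norm_cmult) simp
      finally show ?thesis using C(2)[OF that] C'(2)[OF that] by (simp add: algebra_simps)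
    qed
    have "L2_norm M (W f) \<le> e" if e: "e > 0" for e
    proof -
      \<comment> \<open>The tolerance absorbs the bound \<open>C' + C\<close> of
        \<open>W\<close>.\<close>
      obtain g k where g: "g \<in> L2 M" and k: "k \<in> L2_ker M P"
        and small: "L2_norm M (\<lambda>x. f x - (P g x + k x)) < e / (C' + C)"
        using dense[OF f, of "e / (C' + C)"] e C(1) C'(1) by auto
      have kL: "k \<in> L2 M" using k by (simp add: L2_ker_def)
      have Pg: "P g \<in> L2 M" and P'g: "P' g \<in> L2 M"
        using g L2_bounded_opD(1)[OF P] L2_bounded_opD(1)[OF P'] by auto
      let ?h = "\<lambda>x. P g x + k x" and ?d = "\<lambda>x. f x - (P g x + k x)"
      have h: "?h \<in> L2 M" using Pg kL by (rule L2_add)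
      have dL: "?d \<in> L2 M" using f h by (rule L2_diff)
      have "L2_ker M U = L2_ker M P" "L2_ker M U' = L2_ker M P"
        using d d' by (auto simp: L2_polar_decomp_def)
      with k have "k \<in> L2_ker M U" "k \<in> L2_ker M U'" by simp_all
      then have Uk: "AE x in M. U k x = 0" and U'k: "AE x in M. U' k x = 0"
        by (simp_all add: L2_ker_def)
      have "AE x in M. T g x = U (P g) x" "AE x in M. T g x = U' (P' g) x"
        using L2_op_eqD[of M T "U \<circ> P" g] L2_op_eqD[of M T "U' \<circ> P'" g] d d' g
        by (simp_all add: L2_polar_decomp_def)
      \<comment> \<open>Uniqueness of the absolute value enters here: \<open>U'\<close> is
        prescribed on the range of \<open>P'\<close>, and this must be the range of \<open>P\<close>
        up to null sets.\<close>
      moreover have "AE x in M. U' (P' g) x = U' (P g) x"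
        by (rule L2_bounded_op_cong_AE[OF U' P'g Pg L2_op_eqD[OF PP' g]])
      ultimately have "AE x in M. U' (P g) x = U (P g) x" by eventually_elim simp
      then have "AE x in M. W f x = W ?d x"
        using Uk U'k L2_bounded_op_diff[OF U f h] L2_bounded_op_diff[OF U' f h]
          L2_bounded_opD(2)[OF U Pg kL] L2_bounded_opD(2)[OF U' Pg kL]
        unfolding W_def by eventually_elim simp
      then have "L2_norm M (W f) = L2_norm M (W ?d)"
        using mW f dL by (intro L2_norm_cong_AE) (auto intro!: L2_measurable)
      also have "\<dots> \<le> (C' + C) * L2_norm M ?d" by (rule nW[OF dL])
      also have "\<dots> \<le> e" using small C(1) C'(1) by (simp add: field_simps)
      finally show ?thesis .
    qed
    then have "L2_norm M (W f) \<le> 0" by (rule field_le_epsilon) simp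
    then have "L2_norm M (W f) = 0" by (intro antisym) auto
    then show ?thesis using L2_norm_eq_0_iff[OF mW[OF f]] by (auto simp: W_def)
  qed
  with PP' show ?thesis by (simp add: L2_op_eq_def)
qed

section \<open>Transfer of operator properties along a.e. equality\<close>

lemma L2_op_eq_closed:
  assumes eq: "L2_op_eq M S T" and T: "L2_bounded_op M T"
    and meas: "\<And>f. f \<in> L2 M \<Longrightarrow> S f \<in> borel_measurable M" and f: "f \<in> L2 M"
  shows "S f \<in> L2 M"
  by (rule L2_cong_AE[OF L2_bounded_opD(1)[OF T f] meas[OF f] AE_symmetric[OF L2_op_eqD[OF eq f]]])

lemma L2_op_eq_norm:
  assumes eq: "L2_op_eq M S T" and T: "L2_bounded_op M T"
    and meas: "\<And>f. f \<in> L2 M \<Longrightarrow> S f \<in> borel_measurable M" and f: "f \<in> L2 M"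
  shows "L2_norm M (S f) = L2_norm M (T f)"
  by (rule L2_norm_cong_AE[OF L2_op_eqD[OF eq f] meas[OF f] L2_measurable[OF L2_bounded_opD(1)[OF T f]]])

lemma L2_op_eq_inner:
  assumes eq: "L2_op_eq M S T" and T: "L2_bounded_op M T"
    and meas: "\<And>f. f \<in> L2 M \<Longrightarrow> S f \<in> borel_measurable M" and f: "f \<in> L2 M" and g: "g \<in> L2 M"
  shows "L2_inner M (S f) g = L2_inner M (T f) g"
  using g by (intro L2_inner_cong_AE[OF L2_op_eqD[OF eq f] AE_I2 meas[OF f]
      L2_measurable[OF L2_bounded_opD(1)[OF T f]]]) (simp_all add: L2_measurable)

lemma L2_op_eq_ker:
  assumes "L2_op_eq M S T" shows "L2_ker M S = L2_ker M T"
proof -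
  have "(AE x in M. S f x = 0) \<longleftrightarrow> (AE x in M. T f x = 0)" if "f \<in> L2 M" for f
  proof -
    have "AE x in M. S f x = T f x" using assms that by (simp add: L2_op_eq_def)
    then have "AE x in M. (S f x = 0) = (T f x = 0)" by eventually_elim simp
    then show ?thesis by (rule eventually_subst)
  qed
  then show ?thesis unfolding L2_ker_def by (intro Collect_cong conj_cong) simp_all
qed

lemma L2_op_eq_bounded:
  assumes eq: "L2_op_eq M S T" and T: "L2_bounded_op M T"
    and meas: "\<And>f. f \<in> L2 M \<Longrightarrow> S f \<in> borel_measurable M"
  shows "L2_bounded_op M S"
  unfolding L2_bounded_op_def
proof (intro conjI ballI allI)
  have ae: "AE x in M. S f x = T f x" if "f \<in> L2 M" for f
    using eq that by (rule L2_op_eqD)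
  show "S f \<in> L2 M" if "f \<in> L2 M" for f by (rule L2_op_eq_closed[OF eq T meas that])
  show "AE x in M. S (\<lambda>y. f y + g y) x = S f x + S g x" if "f \<in> L2 M" "g \<in> L2 M" for f g
    using ae[OF that(1)] ae[OF that(2)] ae[OF L2_add[OF that]] L2_bounded_opD(2)[OF T that]
    by eventually_elim simp
  show "AE x in M. S (\<lambda>y. c * f y) x = c * S f x" if "f \<in> L2 M" for c f
    using ae[OF that] ae[OF L2_cmult[OF that, of c]] L2_bounded_opD(3)[OF T that, of c]
    by eventually_elim simp
  obtain C where "\<And>f. f \<in> L2 M \<Longrightarrow> L2_norm M (T f) \<le> C * L2_norm M f"
    using L2_bounded_op_bound[OF T] by metis
  then show "\<exists>C. \<forall>f\<in>L2 M. L2_norm M (S f) \<le> C * L2_norm M f"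
    using L2_op_eq_norm[OF eq T meas] by (intro exI[of _ C]) auto
qed

lemma L2_op_eq_comp:
  assumes S: "L2_op_eq M S S'" "L2_bounded_op M S'" and T: "L2_op_eq M T T'" "L2_bounded_op M T'"
    and meas: "\<And>f. f \<in> L2 M \<Longrightarrow> T f \<in> borel_measurable M"
  shows "L2_op_eq M (S \<circ> T) (S' \<circ> T')"
  unfolding L2_op_eq_def comp_def
proof
  fix f assume f: "f \<in> L2 M"
  have Tf: "T f \<in> L2 M" by (rule L2_op_eq_closed[OF T meas f])
  have "AE x in M. S (T f) x = S' (T f) x" using S(1) Tf by (rule L2_op_eqD)
  moreover have "AE x in M. S' (T f) x = S' (T' f) x"
    by (rule L2_bounded_op_cong_AE[OF S(2) Tf L2_bounded_opD(1)[OF T(2) f] L2_op_eqD[OF T(1) f]])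
  ultimately show "AE x in M. S (T f) x = S' (T' f) x" by eventually_elim simp
qed

text \<open>Allows the explicit formulas to be exchanged for their normal forms; the adjoint of
  \<open>T'\<close> serves \<open>T\<close> as well. Measurability is demanded separately because
  a.e. equality alone does not give membership in \<open>L2 M\<close>.\<close>

lemma L2_polar_decomp_cong:
  assumes d: "L2_polar_decomp M T' U' P'"
    and T: "L2_op_eq M T T'" "\<And>f. f \<in> L2 M \<Longrightarrow> T f \<in> borel_measurable M"
    and U: "L2_op_eq M U U'" "\<And>f. f \<in> L2 M \<Longrightarrow> U f \<in> borel_measurable M"
    and P: "L2_op_eq M P P'" "\<And>f. f \<in> L2 M \<Longrightarrow> P f \<in> borel_measurable M"
  shows "L2_polar_decomp M T U P"
proof -
  obtain T'' where adj: "L2_adjoint M T' T''" and pos': "L2_positive M P'"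
    and sq: "L2_op_eq M (P' \<circ> P') (T'' \<circ> T')"
    using d by (auto simp: L2_polar_decomp_def L2_abs_op_def L2_pos_sqrt_def)
  have BT': "L2_bounded_op M T'" and BU': "L2_bounded_op M U'" and BP': "L2_bounded_op M P'"
    and BT'': "L2_bounded_op M T''"
    using d adj pos' by (auto simp: L2_polar_decomp_def L2_partial_isometry_def
        L2_adjoint_def L2_positive_def)
  note BT = L2_op_eq_bounded[OF T(1) BT' T(2)] and BU = L2_op_eq_bounded[OF U(1) BU' U(2)]
    and BP = L2_op_eq_bounded[OF P(1) BP' P(2)]
  have refl: "L2_op_eq M T'' T''" by (simp add: L2_op_eq_def)
  have "L2_adjoint M T T''"
    using adj L2_op_eq_inner[OF T(1) BT' T(2)] by (simp add: L2_adjoint_def)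
  moreover have "L2_positive M P"
    using pos' BP L2_op_eq_inner[OF P(1) BP' P(2)] by (simp add: L2_positive_def)
  moreover have "L2_op_eq M (P \<circ> P) (T'' \<circ> T)"
    by (rule L2_op_eq_trans[OF L2_op_eq_comp[OF P(1) BP' P(1) BP' P(2)]
          L2_op_eq_trans[OF sq L2_op_eq_sym[OF L2_op_eq_comp[OF refl BT'' T(1) BT' T(2)]]]])
  ultimately have "L2_abs_op M T P"
    unfolding L2_abs_op_def L2_pos_sqrt_def by blast
  moreover have "L2_partial_isometry M U"
    using d BU L2_op_eq_norm[OF U(1) BU' U(2)] L2_op_eq_ker[OF U(1)]
    by (simp add: L2_polar_decomp_def L2_partial_isometry_def)
  moreover have "L2_op_eq M T' (U' \<circ> P')" using d by (simp add: L2_polar_decomp_def)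
  then have "L2_op_eq M T (U \<circ> P)"
    by (rule L2_op_eq_trans[OF T(1) L2_op_eq_trans[OF _
          L2_op_eq_sym[OF L2_op_eq_comp[OF U(1) BU' P(1) BP' P(2)]]]])
  ultimately show ?thesis
    using d BT L2_op_eq_ker[OF T(1)] L2_op_eq_ker[OF U(1)] L2_op_eq_ker[OF P(1)]
    by (simp add: L2_polar_decomp_def)
qed

subsection \<open>Complex conditional expectation\<close>

context sigma_finite_subalgebra
begin

text \<open>Source of the finiteness estimates: \<open>h\<close> will be the modulus of a sum, or
  \<open>|v f|\<close> below \<open>|v|\<^sup>2 + |f|\<^sup>2\<close>.\<close>

lemma nn_cond_exp_real_add_le:
  assumes [measurable]: "f \<in> borel_measurable M" "g \<in> borel_measurable M"
    and h [measurable]: "h \<in> borel_measurable M" and le: "\<And>x. h x \<le> f x + g x"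
    and nonneg: "\<And>x. 0 \<le> f x" "\<And>x. 0 \<le> g x"
  shows "AE x in M. nn_cond_exp M F (\<lambda>y. ennreal (h y)) x
      \<le> nn_cond_exp M F (\<lambda>y. ennreal (f y)) x + nn_cond_exp M F (\<lambda>y. ennreal (g y)) x"
proof -
  have "AE x in M. nn_cond_exp M F (\<lambda>y. ennreal (h y)) x
      \<le> nn_cond_exp M F (\<lambda>y. ennreal (f y) + ennreal (g y)) x"
    using le nonneg by (intro nn_cond_exp_mono) (auto simp: ennreal_plus[symmetric] intro!: ennreal_leI simp del: ennreal_plus)
  moreover have "AE x in M. nn_cond_exp M F (\<lambda>y. ennreal (f y)) x + nn_cond_exp M F (\<lambda>y. ennreal (g y)) x
      = nn_cond_exp M F (\<lambda>y. ennreal (f y) + ennreal (g y)) x"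
    by (rule nn_cond_exp_sum) measurable
  ultimately show ?thesis by eventually_elim simp
qed

lemma nn_cond_exp_real_mono:
  assumes [measurable]: "f \<in> borel_measurable M" "g \<in> borel_measurable M" and "\<And>x. f x \<le> g x"
  shows "AE x in M. nn_cond_exp M F (\<lambda>y. ennreal (f y)) x \<le> nn_cond_exp M F (\<lambda>y. ennreal (g y)) x"
  using assms(3) by (intro nn_cond_exp_mono) (auto intro: ennreal_leI)

lemma nn_cond_exp_zero: "AE x in M. nn_cond_exp M F (\<lambda>_. 0) x = 0"
  using nn_cond_exp_F_meas[of "\<lambda>_. 0"] by (auto elim: eventually_mono)

text \<open>Unlike in the library, additivity and the pull-out property are needed for functions that are
  not integrable, at the points where the conditional expectation of the modulus is finite.  So
  \<open>real_cond_exp\<close> is taken apart into the two \<open>nn_cond_exp\<close> that define it.\<close>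

lemma real_cond_exp_add_finite:
  assumes [measurable]: "f \<in> borel_measurable M" "g \<in> borel_measurable M"
  shows "AE x in M. nn_cond_exp M F (\<lambda>y. ennreal \<bar>f y\<bar>) x < \<infinity> \<longrightarrow>
      nn_cond_exp M F (\<lambda>y. ennreal \<bar>g y\<bar>) x < \<infinity> \<longrightarrow>
      real_cond_exp M F (\<lambda>y. f y + g y) x = real_cond_exp M F f x + real_cond_exp M F g x"
proof -
  let ?N = "\<lambda>h. nn_cond_exp M F (\<lambda>y. ennreal (h y))"
  \<comment> \<open>\<open>ennreal\<close> sends negative reals to 0, so \<open>ennreal a\<close>
    and \<open>ennreal (-a)\<close> are the positive and negative parts of \<open>a\<close>. With
    all terms added and none subtracted, the identity survives in \<open>ennreal\<close> and can be
    conditioned term by term.\<close>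
  have decomp: "ennreal (a + b) + (ennreal (-a) + ennreal (-b)) = ennreal (-(a+b)) + (ennreal a + ennreal b)"
    for a b :: real
    by (cases "a \<ge> 0"; cases "b \<ge> 0"; cases "a + b \<ge> 0")
      (auto simp: ennreal_neg ennreal_plus[symmetric] simp del: ennreal_plus)
  have 1: "AE x in M. ?N (\<lambda>y. f y + g y) x + (?N (\<lambda>y. - f y) x + ?N (\<lambda>y. - g y) x)
      = nn_cond_exp M F (\<lambda>y. ennreal (f y + g y) + (ennreal (- f y) + ennreal (- g y))) x"
    using nn_cond_exp_sum[of "\<lambda>y. ennreal (- f y)" "\<lambda>y. ennreal (- g y)"]
      nn_cond_exp_sum[of "\<lambda>y. ennreal (f y + g y)" "\<lambda>y. ennreal (- f y) + ennreal (- g y)"] by auto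
  have 2: "AE x in M. ?N (\<lambda>y. - (f y + g y)) x + (?N f x + ?N g x)
      = nn_cond_exp M F (\<lambda>y. ennreal (- (f y + g y)) + (ennreal (f y) + ennreal (g y))) x"
    using nn_cond_exp_sum[of "\<lambda>y. ennreal (f y)" "\<lambda>y. ennreal (g y)"]
      nn_cond_exp_sum[of "\<lambda>y. ennreal (- (f y + g y))" "\<lambda>y. ennreal (f y) + ennreal (g y)"] by auto
  have le: "AE x in M. ?N f x \<le> ?N (\<lambda>y. \<bar>f y\<bar>) x" "AE x in M. ?N (\<lambda>y. - f y) x \<le> ?N (\<lambda>y. \<bar>f y\<bar>) x"
    "AE x in M. ?N g x \<le> ?N (\<lambda>y. \<bar>g y\<bar>) x" "AE x in M. ?N (\<lambda>y. - g y) x \<le> ?N (\<lambda>y. \<bar>g y\<bar>) x"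
    by (rule nn_cond_exp_real_mono; (measurable | simp))+
  have le2: "AE x in M. ?N (\<lambda>y. f y + g y) x \<le> ?N (\<lambda>y. \<bar>f y\<bar>) x + ?N (\<lambda>y. \<bar>g y\<bar>) x"
    "AE x in M. ?N (\<lambda>y. - (f y + g y)) x \<le> ?N (\<lambda>y. \<bar>f y\<bar>) x + ?N (\<lambda>y. \<bar>g y\<bar>) x"
    by (rule nn_cond_exp_real_add_le; (measurable | simp))+
  \<comment> \<open>Return to real differences; finiteness is essential because
    \<open>enn2real\<close> maps \<open>\<infinity>\<close> to 0.\<close>
  have arith: "enn2real p - enn2real n = (enn2real a - enn2real a') + (enn2real b - enn2real b')"
    if "p + (a' + b') = n + (a + b)" "a < \<infinity>" "a' < \<infinity>" "b < \<infinity>" "b' < \<infinity>" "p < \<infinity>" "n < \<infinity>"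
    for p n a a' b b' :: ennreal
  proof -
    have "enn2real p + (enn2real a' + enn2real b') = enn2real (p + (a' + b'))"
      using that(2-) by (simp add: enn2real_plus)
    also have "\<dots> = enn2real (n + (a + b))" by (simp only: that(1))
    also have "\<dots> = enn2real n + (enn2real a + enn2real b)"
      using that(2-) by (simp add: enn2real_plus)
    finally show ?thesis by simp
  qed
  show ?thesis
    using 1 2 le le2
  proof eventually_elim
    case (elim x)
    show ?case
    proof (intro impI)
      assume fin: "?N (\<lambda>y. \<bar>f y\<bar>) x < \<infinity>" "?N (\<lambda>y. \<bar>g y\<bar>) x < \<infinity>"
      then have "?N (\<lambda>y. \<bar>f y\<bar>) x + ?N (\<lambda>y. \<bar>g y\<bar>) x < \<infinity>" by simp
      then have "?N f x < \<infinity>" "?N (\<lambda>y. - f y) x < \<infinity>" "?N g x < \<infinity>" "?N (\<lambda>y. - g y) x < \<infinity>"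
        "?N (\<lambda>y. f y + g y) x < \<infinity>" "?N (\<lambda>y. - (f y + g y)) x < \<infinity>"
        using elim(3-8)[THEN le_less_trans] fin by simp_all
      then show "real_cond_exp M F (\<lambda>y. f y + g y) x = real_cond_exp M F f x + real_cond_exp M F g x"
        unfolding real_cond_exp_def using elim(1,2) decomp by (intro arith) simp_all
    qed
  qed
qed

lemma real_cond_exp_mult_finite:
  assumes [measurable]: "c \<in> borel_measurable F" "g \<in> borel_measurable M"
  shows "AE x in M. nn_cond_exp M F (\<lambda>y. ennreal \<bar>g y\<bar>) x < \<infinity> \<longrightarrow>
      real_cond_exp M F (\<lambda>y. c y * g y) x = c x * real_cond_exp M F g x"
proof -
  have [measurable]: "c \<in> borel_measurable M" by (rule measurable_from_subalg[OF subalg assms(1)])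
  let ?N = "\<lambda>h. nn_cond_exp M F (\<lambda>y. ennreal (h y))"
  \<comment> \<open>Positive and negative part of a product; in each summand the factor from
    \<open>c\<close> is nonnegative and \<open>F\<close>-measurable, so the nonnegative pull-out
    property applies.\<close>
  have decomp: "ennreal (a * b) = ennreal a * ennreal b + ennreal (-a) * ennreal (-b)"
    "ennreal (- (a * b)) = ennreal a * ennreal (- b) + ennreal (-a) * ennreal b" for a b :: real
    by (cases "a \<ge> 0"; cases "b \<ge> 0";
        simp add: ennreal_neg ennreal_mult[symmetric] mult_nonneg_nonpos mult_nonpos_nonneg mult_nonpos_nonpos)+
  have *: "AE x in M. nn_cond_exp M F (\<lambda>y. ennreal (c y) * p y + ennreal (- c y) * n y) x
     = ennreal (c x) * nn_cond_exp M F p x + ennreal (- c x) * nn_cond_exp M F n x"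
    if [measurable]: "p \<in> borel_measurable M" "n \<in> borel_measurable M" for p n
    using nn_cond_exp_sum[of "\<lambda>y. ennreal (c y) * p y" "\<lambda>y. ennreal (- c y) * n y"]
      nn_cond_exp_prod[of "\<lambda>y. ennreal (c y)" p] nn_cond_exp_prod[of "\<lambda>y. ennreal (- c y)" n]
    by auto
  have le: "AE x in M. ?N g x \<le> ?N (\<lambda>y. \<bar>g y\<bar>) x" "AE x in M. ?N (\<lambda>y. - g y) x \<le> ?N (\<lambda>y. \<bar>g y\<bar>) x"
    by (rule nn_cond_exp_real_mono; (measurable | simp))+
  have "AE x in M. ?N (\<lambda>y. c y * g y) x = ennreal (c x) * ?N g x + ennreal (- c x) * ?N (\<lambda>y. - g y) x"
    unfolding decomp(1) by (rule *[of "\<lambda>y. ennreal (g y)" "\<lambda>y. ennreal (- g y)"]) simp_all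
  moreover have "AE x in M. ?N (\<lambda>y. - (c y * g y)) x = ennreal (c x) * ?N (\<lambda>y. - g y) x + ennreal (- c x) * ?N g x"
    unfolding decomp(2) by (rule *[of "\<lambda>y. ennreal (- g y)" "\<lambda>y. ennreal (g y)"]) simp_all
  ultimately show ?thesis
    using le
  proof eventually_elim
    case (elim x)
    show ?case
    proof
      assume fin: "?N (\<lambda>y. \<bar>g y\<bar>) x < \<infinity>"
      obtain p where p: "?N g x = ennreal p" "p \<ge> 0"
        using le_less_trans[OF elim(3) fin] by (cases "?N g x") auto
      obtain n where n: "?N (\<lambda>y. - g y) x = ennreal n" "n \<ge> 0"
        using le_less_trans[OF elim(4) fin] by (cases "?N (\<lambda>y. - g y) x") auto
      show "real_cond_exp M F (\<lambda>y. c y * g y) x = c x * real_cond_exp M F g x"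
        using p n unfolding real_cond_exp_def elim(1,2)
        by (cases "c x \<ge> 0") (simp_all add: ennreal_neg enn2real_mult algebra_simps)
    qed
  qed
qed

lemma ccond_exp_measurable [measurable]:
  "ccond_exp M F f \<in> borel_measurable F" "ccond_exp M F f \<in> borel_measurable M"
proof -
  have eq: "ccond_exp M F f = (\<lambda>x. if nn_cond_exp M F (\<lambda>y. ennreal (cmod (f y))) x < \<infinity>
      then complex_of_real (real_cond_exp M F (\<lambda>y. Re (f y)) x)
        + \<i> * complex_of_real (real_cond_exp M F (\<lambda>y. Im (f y)) x) else 0)"
    by (rule ext) (simp add: ccond_exp_def complex_eq_iff)
  show 1: "ccond_exp M F f \<in> borel_measurable F" unfolding eq by measurable
  show "ccond_exp M F f \<in> borel_measurable M" by (rule measurable_from_subalg[OF subalg 1])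
qed

lemma ccond_exp_cong:
  assumes eq: "AE x in M. f x = g x"
    and [measurable]: "f \<in> borel_measurable M" "g \<in> borel_measurable M"
  shows "AE x in M. ccond_exp M F f x = ccond_exp M F g x"
proof -
  have "AE x in M. nn_cond_exp M F (\<lambda>y. ennreal (cmod (f y))) x = nn_cond_exp M F (\<lambda>y. ennreal (cmod (g y))) x"
    using eq by (intro nn_cond_exp_cong) auto
  moreover have "AE x in M. real_cond_exp M F (\<lambda>y. Re (f y)) x = real_cond_exp M F (\<lambda>y. Re (g y)) x"
    using eq by (intro real_cond_exp_cong) auto
  moreover have "AE x in M. real_cond_exp M F (\<lambda>y. Im (f y)) x = real_cond_exp M F (\<lambda>y. Im (g y)) x"
    using eq by (intro real_cond_exp_cong) auto
  ultimately show ?thesis by eventually_elim (simp add: ccond_exp_def)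
qed

lemma nn_cond_exp_Re_Im_le:
  assumes [measurable]: "f \<in> borel_measurable M"
  shows "AE x in M. nn_cond_exp M F (\<lambda>y. ennreal \<bar>Re (f y)\<bar>) x \<le> nn_cond_exp M F (\<lambda>y. ennreal (cmod (f y))) x"
    and "AE x in M. nn_cond_exp M F (\<lambda>y. ennreal \<bar>Im (f y)\<bar>) x \<le> nn_cond_exp M F (\<lambda>y. ennreal (cmod (f y))) x"
  by (rule nn_cond_exp_real_mono[OF _ _ abs_Re_le_cmod] nn_cond_exp_real_mono[OF _ _ abs_Im_le_cmod];
      measurable)+

lemma ccond_exp_add:
  assumes [measurable]: "f \<in> borel_measurable M" "g \<in> borel_measurable M"
    and fin: "AE x in M. nn_cond_exp M F (\<lambda>y. ennreal (cmod (f y))) x < \<infinity>"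
      "AE x in M. nn_cond_exp M F (\<lambda>y. ennreal (cmod (g y))) x < \<infinity>"
  shows "AE x in M. ccond_exp M F (\<lambda>y. f y + g y) x = ccond_exp M F f x + ccond_exp M F g x"
proof -
  have "AE x in M. nn_cond_exp M F (\<lambda>y. ennreal (cmod (f y + g y))) x
     \<le> nn_cond_exp M F (\<lambda>y. ennreal (cmod (f y))) x + nn_cond_exp M F (\<lambda>y. ennreal (cmod (g y))) x"
    by (rule nn_cond_exp_real_add_le[OF _ _ _ norm_triangle_ineq]) simp_all
  moreover have "AE x in M. nn_cond_exp M F (\<lambda>y. ennreal \<bar>Re (f y)\<bar>) x < \<infinity> \<longrightarrow>
      nn_cond_exp M F (\<lambda>y. ennreal \<bar>Re (g y)\<bar>) x < \<infinity> \<longrightarrow>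
      real_cond_exp M F (\<lambda>y. Re (f y) + Re (g y)) x
        = real_cond_exp M F (\<lambda>y. Re (f y)) x + real_cond_exp M F (\<lambda>y. Re (g y)) x"
    "AE x in M. nn_cond_exp M F (\<lambda>y. ennreal \<bar>Im (f y)\<bar>) x < \<infinity> \<longrightarrow>
      nn_cond_exp M F (\<lambda>y. ennreal \<bar>Im (g y)\<bar>) x < \<infinity> \<longrightarrow>
      real_cond_exp M F (\<lambda>y. Im (f y) + Im (g y)) x
        = real_cond_exp M F (\<lambda>y. Im (f y)) x + real_cond_exp M F (\<lambda>y. Im (g y)) x"
    by (rule real_cond_exp_add_finite; measurable)+
  ultimately show ?thesis
    using fin nn_cond_exp_Re_Im_le[OF assms(1)] nn_cond_exp_Re_Im_le[OF assms(2)]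
  proof eventually_elim
    case (elim x)
    have "nn_cond_exp M F (\<lambda>y. ennreal (cmod (f y + g y))) x < \<infinity>"
      using elim(4,5) by (intro le_less_trans[OF elim(1)]) simp
    moreover note elim(6,7)[THEN le_less_trans, OF elim(4)] elim(8,9)[THEN le_less_trans, OF elim(5)]
    ultimately show ?case
      using elim(2-5) by (simp add: ccond_exp_def complex_eq_iff)
  qed
qed

lemma nn_cond_exp_cmod_mult:
  assumes [measurable]: "c \<in> borel_measurable F" "f \<in> borel_measurable M"
  shows "AE x in M. nn_cond_exp M F (\<lambda>y. ennreal (cmod (c y * f y))) x
    = ennreal (cmod (c x)) * nn_cond_exp M F (\<lambda>y. ennreal (cmod (f y))) x"
  using nn_cond_exp_prod[of "\<lambda>y. ennreal (cmod (c y))" "\<lambda>y. ennreal (cmod (f y))"]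
  by (simp add: norm_mult ennreal_mult) (auto elim: eventually_mono)

text \<open>Stated as an implication at each point because \<open>E(|f|)\<close> may be infinite
  elsewhere. Where it is finite, \<open>E(|c f|) = |c| E(|f|)\<close> is finite too, so neither side
  takes the default value 0 and the claim splits into four real products.\<close>

lemma ccond_exp_pull_out:
  assumes [measurable]: "c \<in> borel_measurable F" "f \<in> borel_measurable M"
  shows "AE x in M. nn_cond_exp M F (\<lambda>y. ennreal (cmod (f y))) x < \<infinity> \<longrightarrow>
    ccond_exp M F (\<lambda>y. c y * f y) x = c x * ccond_exp M F f x"
proof -
  have [measurable]: "c \<in> borel_measurable M" by (rule measurable_from_subalg[OF subalg assms(1)])
  have abs: "AE x in M. nn_cond_exp M F (\<lambda>y. ennreal \<bar>d y * g y\<bar>) x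
      = ennreal \<bar>d x\<bar> * nn_cond_exp M F (\<lambda>y. ennreal \<bar>g y\<bar>) x"
    if [measurable]: "d \<in> borel_measurable F" "g \<in> borel_measurable M" for d g :: "'a \<Rightarrow> real"
    using nn_cond_exp_prod[of "\<lambda>y. ennreal \<bar>d y\<bar>" "\<lambda>y. ennreal \<bar>g y\<bar>"]
    by (simp add: abs_mult ennreal_mult) (auto elim: eventually_mono)
  let ?Rc = "\<lambda>y. Re (c y)" and ?Ic = "\<lambda>y. Im (c y)" and ?Rf = "\<lambda>y. Re (f y)" and ?If = "\<lambda>y. Im (f y)"
  note a = real_cond_exp_add_finite[of "\<lambda>y. Re (c y) * Re (f y)" "\<lambda>y. - Im (c y) * Im (f y)"]
    real_cond_exp_add_finite[of "\<lambda>y. Re (c y) * Im (f y)" "\<lambda>y. Im (c y) * Re (f y)"]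
  note m = real_cond_exp_mult_finite[of ?Rc ?Rf] real_cond_exp_mult_finite[of ?Rc ?If]
    real_cond_exp_mult_finite[of "\<lambda>y. - Im (c y)" ?If] real_cond_exp_mult_finite[of ?Ic ?Rf]
  note b = abs[of ?Rc ?Rf] abs[of ?Rc ?If] abs[of "\<lambda>y. - Im (c y)" ?If] abs[of ?Ic ?Rf]
  \<comment> \<open>The minus sign is attached to the \<open>F\<close>-measurable factor, so that
    additivity suffices.\<close>
  have eq: "(\<lambda>y. Re (c y * f y)) = (\<lambda>y. Re (c y) * Re (f y) + - Im (c y) * Im (f y))"
    "(\<lambda>y. Im (c y * f y)) = (\<lambda>y. Re (c y) * Im (f y) + Im (c y) * Re (f y))" by auto
  have meas: "?Rc \<in> borel_measurable F" "?Ic \<in> borel_measurable F" "(\<lambda>y. - Im (c y)) \<in> borel_measurable F"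
    "?Rf \<in> borel_measurable M" "?If \<in> borel_measurable M"
    "?Rc \<in> borel_measurable M" "?Ic \<in> borel_measurable M" by measurable
  have "AE x in M. nn_cond_exp M F (\<lambda>y. ennreal \<bar>Re (c y) * Re (f y)\<bar>) x
      = ennreal \<bar>Re (c x)\<bar> * nn_cond_exp M F (\<lambda>y. ennreal \<bar>Re (f y)\<bar>) x" by (rule b) measurable
  moreover have "AE x in M. nn_cond_exp M F (\<lambda>y. ennreal \<bar>Re (c y) * Im (f y)\<bar>) x
      = ennreal \<bar>Re (c x)\<bar> * nn_cond_exp M F (\<lambda>y. ennreal \<bar>Im (f y)\<bar>) x" by (rule b) measurable
  moreover have "AE x in M. nn_cond_exp M F (\<lambda>y. ennreal \<bar>- Im (c y) * Im (f y)\<bar>) x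
      = ennreal \<bar>- Im (c x)\<bar> * nn_cond_exp M F (\<lambda>y. ennreal \<bar>Im (f y)\<bar>) x" by (rule b) measurable
  moreover have "AE x in M. nn_cond_exp M F (\<lambda>y. ennreal \<bar>Im (c y) * Re (f y)\<bar>) x
      = ennreal \<bar>Im (c x)\<bar> * nn_cond_exp M F (\<lambda>y. ennreal \<bar>Re (f y)\<bar>) x" by (rule b) measurable
  moreover have "AE x in M. nn_cond_exp M F (\<lambda>y. ennreal \<bar>Re (f y)\<bar>) x < \<infinity> \<longrightarrow>
      real_cond_exp M F (\<lambda>y. Re (c y) * Re (f y)) x = Re (c x) * real_cond_exp M F ?Rf x"
    "AE x in M. nn_cond_exp M F (\<lambda>y. ennreal \<bar>Im (f y)\<bar>) x < \<infinity> \<longrightarrow>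
      real_cond_exp M F (\<lambda>y. Re (c y) * Im (f y)) x = Re (c x) * real_cond_exp M F ?If x"
    "AE x in M. nn_cond_exp M F (\<lambda>y. ennreal \<bar>Im (f y)\<bar>) x < \<infinity> \<longrightarrow>
      real_cond_exp M F (\<lambda>y. - Im (c y) * Im (f y)) x = - Im (c x) * real_cond_exp M F ?If x"
    "AE x in M. nn_cond_exp M F (\<lambda>y. ennreal \<bar>Re (f y)\<bar>) x < \<infinity> \<longrightarrow>
      real_cond_exp M F (\<lambda>y. Im (c y) * Re (f y)) x = Im (c x) * real_cond_exp M F ?Rf x"
    by (rule m; measurable)+
  moreover have "AE x in M. nn_cond_exp M F (\<lambda>y. ennreal \<bar>Re (c y) * Re (f y)\<bar>) x < \<infinity> \<longrightarrow>
      nn_cond_exp M F (\<lambda>y. ennreal \<bar>- Im (c y) * Im (f y)\<bar>) x < \<infinity> \<longrightarrow>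
      real_cond_exp M F (\<lambda>y. Re (c y) * Re (f y) + - Im (c y) * Im (f y)) x =
      real_cond_exp M F (\<lambda>y. Re (c y) * Re (f y)) x + real_cond_exp M F (\<lambda>y. - Im (c y) * Im (f y)) x"
    "AE x in M. nn_cond_exp M F (\<lambda>y. ennreal \<bar>Re (c y) * Im (f y)\<bar>) x < \<infinity> \<longrightarrow>
      nn_cond_exp M F (\<lambda>y. ennreal \<bar>Im (c y) * Re (f y)\<bar>) x < \<infinity> \<longrightarrow>
      real_cond_exp M F (\<lambda>y. Re (c y) * Im (f y) + Im (c y) * Re (f y)) x =
      real_cond_exp M F (\<lambda>y. Re (c y) * Im (f y)) x + real_cond_exp M F (\<lambda>y. Im (c y) * Re (f y)) x"
    by (rule a; measurable)+
  ultimately show ?thesis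
    using nn_cond_exp_Re_Im_le[OF assms(2)] nn_cond_exp_cmod_mult[OF assms]
  proof eventually_elim
    case (elim x)
    show ?case
    proof
    assume f: "nn_cond_exp M F (\<lambda>y. ennreal (cmod (f y))) x < \<infinity>"
    have fin: "nn_cond_exp M F (\<lambda>y. ennreal \<bar>Re (f y)\<bar>) x < \<infinity>"
      "nn_cond_exp M F (\<lambda>y. ennreal \<bar>Im (f y)\<bar>) x < \<infinity>"
      using elim(11,12)[THEN le_less_trans] f by simp_all
    have "nn_cond_exp M F (\<lambda>y. ennreal (cmod (c y * f y))) x < \<infinity>"
      unfolding elim(13) using f by (simp add: ennreal_mult_less_top)
    moreover have "real_cond_exp M F (\<lambda>y. Re (c y * f y)) x
        = Re (c x) * real_cond_exp M F ?Rf x - Im (c x) * real_cond_exp M F ?If x"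
      unfolding eq using elim fin by (simp add: ennreal_mult_less_top)
    moreover have "real_cond_exp M F (\<lambda>y. Im (c y * f y)) x
        = Re (c x) * real_cond_exp M F ?If x + Im (c x) * real_cond_exp M F ?Rf x"
      unfolding eq using elim fin by (simp add: ennreal_mult_less_top)
    ultimately show "ccond_exp M F (\<lambda>y. c y * f y) x = c x * ccond_exp M F f x"
      using f by (simp add: ccond_exp_def complex_eq_iff)
    qed
  qed
qed

text \<open>Valid at every point: the modulus is unchanged, so the default applies at the same
  points, and replacing \<open>h\<close> by \<open>-h\<close> merely swaps the two nonnegative
  expectations in \<open>real_cond_exp\<close>.\<close>

lemma ccond_exp_cnj: "ccond_exp M F (\<lambda>y. cnj (f y)) x = cnj (ccond_exp M F f x)"
  by (simp add: ccond_exp_def complex_eq_iff real_cond_exp_def)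

text \<open>The sharp constant is \<open>1\<close>; the crude one suffices for boundedness.\<close>

lemma cmod_ccond_exp_le:
  assumes [measurable]: "f \<in> borel_measurable M"
  shows "AE x in M. ennreal (cmod (ccond_exp M F f x)) \<le> 2 * nn_cond_exp M F (\<lambda>y. ennreal (cmod (f y))) x"
proof -
  have "AE x in M. ennreal \<bar>real_cond_exp M F (\<lambda>y. Re (f y)) x\<bar> \<le> nn_cond_exp M F (\<lambda>y. ennreal \<bar>Re (f y)\<bar>) x"
    "AE x in M. ennreal \<bar>real_cond_exp M F (\<lambda>y. Im (f y)) x\<bar> \<le> nn_cond_exp M F (\<lambda>y. ennreal \<bar>Im (f y)\<bar>) x"
    by (rule real_cond_exp_abs; measurable)+
  then show ?thesis using nn_cond_exp_Re_Im_le[OF assms]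
  proof eventually_elim
    case (elim x)
    have "ennreal (cmod (ccond_exp M F f x)) \<le> ennreal (\<bar>real_cond_exp M F (\<lambda>y. Re (f y)) x\<bar>
        + \<bar>real_cond_exp M F (\<lambda>y. Im (f y)) x\<bar>)"
      using cmod_le[of "Complex (real_cond_exp M F (\<lambda>y. Re (f y)) x) (real_cond_exp M F (\<lambda>y. Im (f y)) x)"]
      by (intro ennreal_leI) (auto simp: ccond_exp_def)
    also have "\<dots> \<le> nn_cond_exp M F (\<lambda>y. ennreal (cmod (f y))) x + nn_cond_exp M F (\<lambda>y. ennreal (cmod (f y))) x"
      unfolding ennreal_plus[OF abs_ge_zero abs_ge_zero]
      by (rule add_mono[OF order_trans[OF elim(1,3)] order_trans[OF elim(2,4)]])
    finally show ?case by (simp add: mult_2)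
  qed
qed

lemma ccond_exp_of_real:
  assumes [measurable]: "h \<in> borel_measurable M" and nonneg: "\<And>x. 0 \<le> h x"
    and fin: "AE x in M. nn_cond_exp M F (\<lambda>y. ennreal (h y)) x < \<infinity>"
  shows "AE x in M. ccond_exp M F (\<lambda>y. complex_of_real (h y)) x
    = complex_of_real (enn2real (nn_cond_exp M F (\<lambda>y. ennreal (h y)) x))"
  using fin nn_cond_exp_zero
proof eventually_elim
  case (elim x)
  then show ?case
    using nonneg by (simp add: ccond_exp_def complex_eq_iff real_cond_exp_def ennreal_neg)
qed

text \<open>The defining property of \<open>E\<close> tested against an \<open>F\<close>-measurable
  \<open>c\<close>, with integrability demanded of \<open>c f\<close> and not of \<open>f\<close>.
  It yields the adjoint formula.\<close>

lemma integral_mult_ccond_exp: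
  assumes [measurable]: "c \<in> borel_measurable F" "f \<in> borel_measurable M"
    and fin: "AE x in M. nn_cond_exp M F (\<lambda>y. ennreal (cmod (f y))) x < \<infinity>"
    and int: "integrable M (\<lambda>x. c x * f x)"
  shows "(\<integral>x. c x * f x \<partial>M) = (\<integral>x. c x * ccond_exp M F f x \<partial>M)"
proof -
  have [measurable]: "c \<in> borel_measurable M" by (rule measurable_from_subalg[OF subalg assms(1)])
  let ?Rc = "\<lambda>y. Re (c y)" and ?Ic = "\<lambda>y. Im (c y)" and ?Rf = "\<lambda>y. Re (f y)" and ?If = "\<lambda>y. Im (f y)"
  \<comment> \<open>Each of the four real products is dominated by \<open>|c f|\<close>.\<close>
  have prod_int: "integrable M (\<lambda>x. p x * q x)"
    if [measurable]: "p \<in> borel_measurable M" "q \<in> borel_measurable M"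
      and le: "\<And>x. \<bar>p x\<bar> \<le> cmod (c x)" "\<And>x. \<bar>q x\<bar> \<le> cmod (f x)" for p q :: "'a \<Rightarrow> real"
    using int by (rule Bochner_Integration.integrable_bound)
      (auto simp: abs_mult norm_mult intro!: mult_mono le)
  have i: "integrable M (\<lambda>x. Re (c x) * Re (f x))" "integrable M (\<lambda>x. Re (c x) * Im (f x))"
    "integrable M (\<lambda>x. Im (c x) * Re (f x))" "integrable M (\<lambda>x. Im (c x) * Im (f x))"
    by (rule prod_int; (rule abs_Re_le_cmod abs_Im_le_cmod | measurable))+
  let ?ER = "real_cond_exp M F ?Rf" and ?EI = "real_cond_exp M F ?If"
  have k: "integrable M (\<lambda>x. Re (c x) * ?ER x)" "integrable M (\<lambda>x. Re (c x) * ?EI x)"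
    "integrable M (\<lambda>x. Im (c x) * ?ER x)" "integrable M (\<lambda>x. Im (c x) * ?EI x)"
    by ((rule real_cond_exp_intg(1), rule i; measurable))+
  have e: "(\<integral>x. Re (c x) * ?ER x \<partial>M) = (\<integral>x. Re (c x) * Re (f x) \<partial>M)"
    "(\<integral>x. Re (c x) * ?EI x \<partial>M) = (\<integral>x. Re (c x) * Im (f x) \<partial>M)"
    "(\<integral>x. Im (c x) * ?ER x \<partial>M) = (\<integral>x. Im (c x) * Re (f x) \<partial>M)"
    "(\<integral>x. Im (c x) * ?EI x \<partial>M) = (\<integral>x. Im (c x) * Im (f x) \<partial>M)"
    by ((rule real_cond_exp_intg(2), rule i; measurable))+
  \<comment> \<open>This is \<open>c E(f)\<close> with real and imaginary parts multiplied out and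
    without the default value; by \<open>fin\<close> the difference is a null set.\<close>
  define g where "g = (\<lambda>x. complex_of_real (Re (c x) * ?ER x - Im (c x) * ?EI x)
      + \<i> * complex_of_real (Re (c x) * ?EI x + Im (c x) * ?ER x))"
  have [measurable]: "g \<in> borel_measurable M" unfolding g_def by measurable
  have "(\<integral>x. c x * f x \<partial>M) = (\<integral>x. complex_of_real (Re (c x) * Re (f x) - Im (c x) * Im (f x))
      + \<i> * complex_of_real (Re (c x) * Im (f x) + Im (c x) * Re (f x)) \<partial>M)"
    by (intro Bochner_Integration.integral_cong) (auto simp: complex_eq_iff)
  also have "\<dots> = (\<integral>x. g x \<partial>M)"
    unfolding g_def using i k e
    by (simp add: Bochner_Integration.integral_add Bochner_Integration.integral_diff
        integral_complex_of_real del: of_real_add of_real_diff of_real_mult)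
  also have "\<dots> = (\<integral>x. c x * ccond_exp M F f x \<partial>M)"
  proof (rule integral_cong_AE)
    show "AE x in M. g x = c x * ccond_exp M F f x"
      using fin by eventually_elim (simp add: g_def ccond_exp_def complex_eq_iff)
  qed measurable
  finally show ?thesis .
qed

end

subsection \<open>Weighted conditional expectation operators\<close>

text \<open>The admissible weights: a bounded conditional second moment makes \<open>E(v f)\<close>
  defined a.e. for every \<open>f\<close> in \<open>L2 M\<close> and the weighted operators bounded.
  Positivity of \<open>C\<close> permits division by it.\<close>

definition cond_sq_bounded :: "'a measure \<Rightarrow> 'a measure \<Rightarrow> ('a \<Rightarrow> complex) \<Rightarrow> real \<Rightarrow> bool" where
  "cond_sq_bounded M F v C \<longleftrightarrow>
     0 < C \<and> v \<in> borel_measurable M \<and> (AE x in M. cond_sq M F v x \<le> ennreal C)"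

lemma cond_sq_bounded_measurable: "cond_sq_bounded M F v C \<Longrightarrow> v \<in> borel_measurable M"
  by (simp add: cond_sq_bounded_def)

lemma cond_sq_bounded_cnj:
  assumes "cond_sq_bounded M F v C" shows "cond_sq_bounded M F (\<lambda>x. cnj (v x)) C"
proof -
  have [measurable]: "v \<in> borel_measurable M" using assms by (rule cond_sq_bounded_measurable)
  have "(\<lambda>x. cnj (v x)) \<in> borel_measurable M" by measurable
  with assms show ?thesis by (simp add: cond_sq_bounded_def cond_sq_def)
qed

context sigma_finite_subalgebra
begin

lemma cond_sq_measurable [measurable]:
  "cond_sq M F g \<in> borel_measurable F" "cond_sq M F g \<in> borel_measurable M"
  unfolding cond_sq_def by measurable

lemma nn_integral_cond_sq:
  assumes [measurable]: "f \<in> borel_measurable M"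
  shows "(\<integral>\<^sup>+x. cond_sq M F f x \<partial>M) = (\<integral>\<^sup>+x. ennreal ((cmod (f x))\<^sup>2) \<partial>M)"
  using nn_cond_exp_intg[of "\<lambda>_. 1" "\<lambda>x. ennreal ((cmod (f x))\<^sup>2)"] by (simp add: cond_sq_def)

lemma L2_nn_integral:
  assumes "f \<in> L2 M"
  shows "(\<integral>\<^sup>+x. ennreal ((cmod (f x))\<^sup>2) \<partial>M) = ennreal ((L2_norm M f)\<^sup>2)"
  unfolding L2_norm_sq using L2_integrable[OF assms] by (intro nn_integral_eq_integral) auto

lemma cond_sq_L2_finite:
  assumes f: "f \<in> L2 M" shows "AE x in M. cond_sq M F f x < \<infinity>"
proof -
  have "(\<integral>\<^sup>+x. cond_sq M F f x \<partial>M) \<noteq> \<infinity>"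
    using nn_integral_cond_sq[OF L2_measurable[OF f]] L2_nn_integral[OF f] by simp
  then have "AE x in M. cond_sq M F f x \<noteq> \<infinity>" by (intro nn_integral_PInf_AE) measurable
  then show ?thesis by eventually_elim (simp add: less_top)
qed

text \<open>A crude estimate that supplies finiteness; the conditional Cauchy-Schwarz argument
  relies on it, since its parameter \<open>t\<close> must be real valued.\<close>

lemma nn_cond_exp_mult_le_cond_sq:
  assumes [measurable]: "v \<in> borel_measurable M" "f \<in> borel_measurable M"
  shows "AE x in M. nn_cond_exp M F (\<lambda>y. ennreal (cmod (v y * f y))) x \<le> cond_sq M F v x + cond_sq M F f x"
  unfolding cond_sq_def
proof (rule nn_cond_exp_real_add_le)
  fix x
  have "a * b \<le> a\<^sup>2 + b\<^sup>2" for a b :: real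
    using zero_le_power2[of "a - b"] zero_le_power2[of a] zero_le_power2[of b]
    unfolding power2_diff by linarith
  then show "cmod (v x * f x) \<le> (cmod (v x))\<^sup>2 + (cmod (f x))\<^sup>2" by (simp add: norm_mult)
qed simp_all

lemma nn_cond_exp_mult_finite:
  assumes v: "v \<in> borel_measurable M" "AE x in M. cond_sq M F v x < \<infinity>"
    and f: "f \<in> borel_measurable M" "AE x in M. cond_sq M F f x < \<infinity>"
  shows "AE x in M. nn_cond_exp M F (\<lambda>y. ennreal (cmod (v y * f y))) x < \<infinity>"
  using nn_cond_exp_mult_le_cond_sq[OF v(1) f(1)] v(2) f(2)
proof eventually_elim
  case (elim x)
  then show ?case by (intro le_less_trans[OF elim(1)]) simp
qed

lemma cond_sq_bounded_finite:
  assumes "cond_sq_bounded M F v C" shows "AE x in M. cond_sq M F v x < \<infinity>"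
proof -
  have "AE x in M. cond_sq M F v x \<le> ennreal C" using assms by (simp add: cond_sq_bounded_def)
  then show ?thesis by eventually_elim (simp add: le_less_trans)
qed

lemma nn_cond_exp_mult_L2_finite:
  assumes v: "cond_sq_bounded M F v C" and f: "f \<in> L2 M"
  shows "AE x in M. nn_cond_exp M F (\<lambda>y. ennreal (cmod (v y * f y))) x < \<infinity>"
  by (rule nn_cond_exp_mult_finite[OF cond_sq_bounded_measurable[OF v] cond_sq_bounded_finite[OF v]
        L2_measurable[OF f] cond_sq_L2_finite[OF f]])

text \<open>The conditional Cauchy-Schwarz inequality, from \<open>2 t |v f| \<le> t\<^sup>2 |v|\<^sup>2 / C + C |f|\<^sup>2\<close> with the
  \<open>F\<close>-measurable choice \<open>t = E(|v f|)\<close>.\<close>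

lemma cond_Cauchy_Schwarz:
  assumes v: "cond_sq_bounded M F v C" and f: "f \<in> L2 M"
  shows "AE x in M. (nn_cond_exp M F (\<lambda>y. ennreal (cmod (v y * f y))) x)\<^sup>2 \<le> ennreal C * cond_sq M F f x"
proof -
  have [measurable]: "v \<in> borel_measurable M" "f \<in> borel_measurable M"
    using v f by (auto simp: cond_sq_bounded_def L2_def)
  have C: "C > 0" and vC: "AE x in M. cond_sq M F v x \<le> ennreal C"
    using v by (auto simp: cond_sq_bounded_def)
  let ?N = "nn_cond_exp M F (\<lambda>y. ennreal (cmod (v y * f y)))"
  \<comment> \<open>\<open>enn2real\<close> makes \<open>t\<close> a real coefficient at every
    point; by finiteness it equals \<open>?N\<close> a.e.\<close>
  define t where "t = (\<lambda>x. enn2real (?N x))"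
  have [measurable]: "t \<in> borel_measurable F" unfolding t_def by measurable
  have [measurable]: "t \<in> borel_measurable M" by (rule measurable_from_subalg[OF subalg]) measurable
  have t0: "t x \<ge> 0" for x by (simp add: t_def)
  have pointwise: "ennreal (2 * t y) * ennreal (cmod (v y * f y))
     \<le> ennreal ((t y)\<^sup>2 / C) * ennreal ((cmod (v y))\<^sup>2) + ennreal C * ennreal ((cmod (f y))\<^sup>2)" for y
  proof -
    have "0 \<le> (t y * cmod (v y) - C * cmod (f y))\<^sup>2 / C" using C by simp
    also have "\<dots> = (t y)\<^sup>2 / C * (cmod (v y))\<^sup>2 + C * (cmod (f y))\<^sup>2 - 2 * t y * cmod (v y * f y)"
      using C by (simp add: power2_eq_square field_simps norm_mult)
    finally have "2 * t y * cmod (v y * f y) \<le> (t y)\<^sup>2 / C * (cmod (v y))\<^sup>2 + C * (cmod (f y))\<^sup>2" by simp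
    then have "ennreal (2 * t y * cmod (v y * f y)) \<le> ennreal ((t y)\<^sup>2 / C * (cmod (v y))\<^sup>2 + C * (cmod (f y))\<^sup>2)"
      by (rule ennreal_leI)
    also have "\<dots> = ennreal ((t y)\<^sup>2 / C) * ennreal ((cmod (v y))\<^sup>2) + ennreal C * ennreal ((cmod (f y))\<^sup>2)"
      using C by (subst ennreal_plus) (auto simp only: ennreal_mult' zero_le_power2 less_imp_le
        divide_nonneg_pos mult_nonneg_nonneg)
    also have "ennreal (2 * t y * cmod (v y * f y)) = ennreal (2 * t y) * ennreal (cmod (v y * f y))"
      using t0[of y] by (intro ennreal_mult) auto
    finally show ?thesis .
  qed
  have 1: "AE x in M. ennreal (2 * t x) * ?N x
      = nn_cond_exp M F (\<lambda>y. ennreal (2 * t y) * ennreal (cmod (v y * f y))) x"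
    by (rule nn_cond_exp_prod) measurable
  have 2: "AE x in M. nn_cond_exp M F (\<lambda>y. ennreal (2 * t y) * ennreal (cmod (v y * f y))) x
      \<le> nn_cond_exp M F (\<lambda>y. ennreal ((t y)\<^sup>2 / C) * ennreal ((cmod (v y))\<^sup>2) + ennreal C * ennreal ((cmod (f y))\<^sup>2)) x"
    by (rule nn_cond_exp_mono[OF AE_I2[OF pointwise]]) measurable
  have 3: "AE x in M. nn_cond_exp M F (\<lambda>y. ennreal ((t y)\<^sup>2 / C) * ennreal ((cmod (v y))\<^sup>2)) x
      + nn_cond_exp M F (\<lambda>y. ennreal C * ennreal ((cmod (f y))\<^sup>2)) x
      = nn_cond_exp M F (\<lambda>y. ennreal ((t y)\<^sup>2 / C) * ennreal ((cmod (v y))\<^sup>2) + ennreal C * ennreal ((cmod (f y))\<^sup>2)) x"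
    by (rule nn_cond_exp_sum) measurable
  have 4: "AE x in M. ennreal ((t x)\<^sup>2 / C) * cond_sq M F v x
      = nn_cond_exp M F (\<lambda>y. ennreal ((t y)\<^sup>2 / C) * ennreal ((cmod (v y))\<^sup>2)) x"
    unfolding cond_sq_def by (rule nn_cond_exp_prod) measurable
  have 5: "AE x in M. ennreal C * cond_sq M F f x
      = nn_cond_exp M F (\<lambda>y. ennreal C * ennreal ((cmod (f y))\<^sup>2)) x"
    unfolding cond_sq_def by (rule nn_cond_exp_prod) measurable
  show ?thesis
    using 1 2 3 4 5 vC nn_cond_exp_mult_L2_finite[OF v f] cond_sq_L2_finite[OF f]
  proof eventually_elim
    case (elim x)
    have Nt: "?N x = ennreal (t x)" using elim(7) by (simp add: t_def)
    obtain s where s: "cond_sq M F f x = ennreal s" "s \<ge> 0"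
      using elim(8) by (cases "cond_sq M F f x") auto
    have "ennreal (2 * t x) * ?N x \<le> ennreal ((t x)\<^sup>2 / C) * cond_sq M F v x + ennreal C * cond_sq M F f x"
      unfolding elim(1) elim(4) elim(5) elim(3) by (rule elim(2))
    also have "\<dots> \<le> ennreal ((t x)\<^sup>2 / C) * ennreal C + ennreal C * cond_sq M F f x"
      by (intro add_mono mult_left_mono elim(6)) auto
    also have "\<dots> = ennreal ((t x)\<^sup>2 + C * s)"
      using C s by (simp add: ennreal_mult[symmetric] ennreal_plus[symmetric] del: ennreal_plus)
    finally have "2 * t x * t x \<le> (t x)\<^sup>2 + C * s"
      unfolding Nt using t0[of x] C s by (simp add: ennreal_mult[symmetric] del: ennreal_plus)
    then have "(t x)\<^sup>2 \<le> C * s" by (simp add: power2_eq_square)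
    then show ?case
      unfolding Nt s(1) using t0[of x] C s by (simp add: ennreal_power ennreal_mult[symmetric] ennreal_leI)
  qed
qed

section \<open>Boundedness, adjoints and products\<close>

lemma wce_op_measurable [measurable]:
  assumes [measurable]: "v \<in> borel_measurable M"
  shows "wce_op M F v z f \<in> borel_measurable M"
  unfolding wce_op_def by measurable

text \<open>\<open>E(z f)\<close> is \<open>F\<close>-measurable, so under the integral
  \<open>|v|\<^sup>2\<close> may be replaced by \<open>E(|v|\<^sup>2) \<le> C\<close>; conditional
  Cauchy-Schwarz then bounds \<open>E(z f)\<close>. The 4 is the square of the constant in
  \<open>cmod_ccond_exp_le\<close>.\<close>

lemma wce_op_L2:
  assumes v: "cond_sq_bounded M F v C" and z: "cond_sq_bounded M F z D" and f: "f \<in> L2 M"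
  shows "wce_op M F v z f \<in> L2 M"
    and "L2_norm M (wce_op M F v z f) \<le> sqrt (4 * C * D) * L2_norm M f"
proof -
  have [measurable]: "v \<in> borel_measurable M" "z \<in> borel_measurable M" "f \<in> borel_measurable M"
    using v z f by (auto simp: cond_sq_bounded_def L2_def)
  have C: "C > 0" and D: "D > 0" and vC: "AE x in M. cond_sq M F v x \<le> ennreal C"
    using v z by (auto simp: cond_sq_bounded_def)
  let ?N = "nn_cond_exp M F (\<lambda>y. ennreal (cmod (z y * f y)))"
  let ?T = "wce_op M F v z f"
  have "(\<integral>\<^sup>+x. ennreal ((cmod (?T x))\<^sup>2) \<partial>M) \<le> (\<integral>\<^sup>+x. (2 * ?N x)\<^sup>2 * ennreal ((cmod (v x))\<^sup>2) \<partial>M)"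
  proof (rule nn_integral_mono_AE)
    have "AE x in M. ennreal (cmod (ccond_exp M F (\<lambda>y. z y * f y) x)) \<le> 2 * ?N x"
      by (rule cmod_ccond_exp_le) measurable
    then show "AE x in M. ennreal ((cmod (?T x))\<^sup>2) \<le> (2 * ?N x)\<^sup>2 * ennreal ((cmod (v x))\<^sup>2)"
    proof eventually_elim
      case (elim x)
      have "ennreal ((cmod (?T x))\<^sup>2) = (ennreal (cmod (ccond_exp M F (\<lambda>y. z y * f y) x)))\<^sup>2 * ennreal ((cmod (v x))\<^sup>2)"
        by (simp add: wce_op_def norm_mult power_mult_distrib ennreal_mult ennreal_power mult.commute)
      also have "\<dots> \<le> (2 * ?N x)\<^sup>2 * ennreal ((cmod (v x))\<^sup>2)"
        using elim by (intro mult_right_mono power_mono) auto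
      finally show ?case .
    qed
  qed
  also have "\<dots> = (\<integral>\<^sup>+x. (2 * ?N x)\<^sup>2 * cond_sq M F v x \<partial>M)"
    unfolding cond_sq_def by (rule nn_cond_exp_intg[symmetric]) measurable
  also have "\<dots> \<le> (\<integral>\<^sup>+x. ennreal (4 * C * D) * cond_sq M F f x \<partial>M)"
  proof (rule nn_integral_mono_AE)
    show "AE x in M. (2 * ?N x)\<^sup>2 * cond_sq M F v x \<le> ennreal (4 * C * D) * cond_sq M F f x"
      using cond_Cauchy_Schwarz[OF z f] vC
    proof eventually_elim
      case (elim x)
      have "(2 * ?N x)\<^sup>2 * cond_sq M F v x = 4 * (?N x)\<^sup>2 * cond_sq M F v x"
        by (simp add: power_mult_distrib)
      also have "\<dots> \<le> 4 * (ennreal D * cond_sq M F f x) * ennreal C"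
        by (intro mult_mono elim order_refl) auto
      also have "\<dots> = ennreal (4 * C * D) * cond_sq M F f x"
        using C D by (simp add: ennreal_mult mult_ac)
      finally show ?case .
    qed
  qed
  also have "\<dots> = ennreal (4 * C * D) * (\<integral>\<^sup>+x. cond_sq M F f x \<partial>M)"
    by (rule nn_integral_cmult) measurable
  also have "\<dots> = ennreal (4 * C * D * (L2_norm M f)\<^sup>2)"
    using C D nn_integral_cond_sq[of f] L2_nn_integral[OF f] by (simp add: ennreal_mult)
  finally have le: "(\<integral>\<^sup>+x. ennreal ((cmod (?T x))\<^sup>2) \<partial>M) \<le> ennreal (4 * C * D * (L2_norm M f)\<^sup>2)" .
  show L2: "?T \<in> L2 M"
  proof (rule L2_I)
    show "integrable M (\<lambda>x. (cmod (?T x))\<^sup>2)"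
      using le by (intro integrableI_bounded) (auto simp: le_less_trans)
  qed measurable
  have "(L2_norm M ?T)\<^sup>2 \<le> 4 * C * D * (L2_norm M f)\<^sup>2"
    using le C D unfolding L2_nn_integral[OF L2] by simp
  then have "L2_norm M ?T \<le> sqrt (4 * C * D * (L2_norm M f)\<^sup>2)" by (rule real_le_rsqrt)
  then show "L2_norm M ?T \<le> sqrt (4 * C * D) * L2_norm M f"
    by (simp add: real_sqrt_mult)
qed

lemma wce_op_bounded_op:
  assumes v: "cond_sq_bounded M F v C" and z: "cond_sq_bounded M F z D"
  shows "L2_bounded_op M (wce_op M F v z)"
  unfolding L2_bounded_op_def
proof (intro conjI ballI allI)
  have [measurable]: "v \<in> borel_measurable M" "z \<in> borel_measurable M"
    using v z by (auto simp: cond_sq_bounded_def)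
  show "wce_op M F v z f \<in> L2 M" if "f \<in> L2 M" for f by (rule wce_op_L2(1)[OF v z that])
  show "\<exists>C. \<forall>f\<in>L2 M. L2_norm M (wce_op M F v z f) \<le> C * L2_norm M f"
    using wce_op_L2(2)[OF v z] by blast
  show "AE x in M. wce_op M F v z (\<lambda>y. f y + g y) x = wce_op M F v z f x + wce_op M F v z g x"
    if "f \<in> L2 M" "g \<in> L2 M" for f g
  proof -
    have [measurable]: "f \<in> borel_measurable M" "g \<in> borel_measurable M" using that by (auto simp: L2_def)
    have "AE x in M. ccond_exp M F (\<lambda>y. z y * f y + z y * g y) x
        = ccond_exp M F (\<lambda>y. z y * f y) x + ccond_exp M F (\<lambda>y. z y * g y) x"
      using nn_cond_exp_mult_L2_finite[OF z that(1)] nn_cond_exp_mult_L2_finite[OF z that(2)]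
      by (intro ccond_exp_add) measurable
    then show ?thesis by eventually_elim (simp add: wce_op_def distrib_left)
  qed
  show "AE x in M. wce_op M F v z (\<lambda>y. c * f y) x = c * wce_op M F v z f x"
    if "f \<in> L2 M" for c f
  proof -
    have [measurable]: "f \<in> borel_measurable M" using that by (auto simp: L2_def)
    have "AE x in M. nn_cond_exp M F (\<lambda>y. ennreal (cmod (z y * f y))) x < \<infinity> \<longrightarrow>
        ccond_exp M F (\<lambda>y. c * (z y * f y)) x = c * ccond_exp M F (\<lambda>y. z y * f y) x"
      by (rule ccond_exp_pull_out) measurable
    with nn_cond_exp_mult_L2_finite[OF z that] show ?thesis
      by eventually_elim (simp add: wce_op_def mult.left_commute)
  qed
qed

text \<open>Each inner product has one \<open>F\<close>-measurable factor, so the other may be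
  averaged; both sides of the adjoint relation reach the same symmetric integral. The integral form
  also gives positivity of \<open>Pop\<close>.\<close>

lemma wce_op_inner:
  assumes v: "cond_sq_bounded M F v C" and z: "cond_sq_bounded M F z D"
    and f: "f \<in> L2 M" and g: "g \<in> L2 M"
  shows "L2_inner M (wce_op M F v z f) g
    = (\<integral>x. ccond_exp M F (\<lambda>y. z y * f y) x * ccond_exp M F (\<lambda>y. v y * cnj (g y)) x \<partial>M)" (is ?A)
    and "L2_inner M (wce_op M F v z f) g
    = L2_inner M f (wce_op M F (\<lambda>x. cnj (z x)) (\<lambda>x. cnj (v x)) g)" (is ?B)
proof -
  have [measurable]: "v \<in> borel_measurable M" "z \<in> borel_measurable M" "f \<in> borel_measurable M"
     "g \<in> borel_measurable M"
    using v z f g by (auto simp: cond_sq_bounded_def L2_def)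
  let ?T' = "wce_op M F (\<lambda>x. cnj (z x)) (\<lambda>x. cnj (v x))"
  define \<phi> where "\<phi> = (\<lambda>x. z x * f x)"
  define \<psi> where "\<psi> = (\<lambda>x. v x * cnj (g x))"
  have [measurable]: "\<phi> \<in> borel_measurable M" "\<psi> \<in> borel_measurable M"
    unfolding \<phi>_def \<psi>_def by measurable
  have E\<psi>: "ccond_exp M F (\<lambda>y. cnj (v y) * g y) x = cnj (ccond_exp M F \<psi> x)" for x
    using ccond_exp_cnj[of \<psi> x] by (simp add: \<psi>_def)
  have fin: "AE x in M. nn_cond_exp M F (\<lambda>y. ennreal (cmod (\<phi> y))) x < \<infinity>"
    "AE x in M. nn_cond_exp M F (\<lambda>y. ennreal (cmod (\<psi> y))) x < \<infinity>"
    using nn_cond_exp_mult_L2_finite[OF z f] nn_cond_exp_mult_L2_finite[OF v g]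
    by (simp_all add: \<phi>_def \<psi>_def norm_mult)
  have l: "wce_op M F v z f x * cnj (g x) = ccond_exp M F \<phi> x * \<psi> x" for x
    by (simp add: wce_op_def \<phi>_def \<psi>_def mult_ac)
  have r: "f x * cnj (?T' g x) = ccond_exp M F \<psi> x * \<phi> x" for x
    unfolding wce_op_def E\<psi> by (simp add: \<phi>_def mult_ac)
  have "integrable M (\<lambda>x. ccond_exp M F \<phi> x * \<psi> x)"
    using L2_inner_integrable[OF wce_op_L2(1)[OF v z f] g] unfolding l .
  then have L: "L2_inner M (wce_op M F v z f) g = (\<integral>x. ccond_exp M F \<phi> x * ccond_exp M F \<psi> x \<partial>M)"
    unfolding L2_inner_def l using fin by (intro integral_mult_ccond_exp) auto
  then show ?A by (simp add: \<phi>_def \<psi>_def)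
  have "integrable M (\<lambda>x. ccond_exp M F \<psi> x * \<phi> x)"
    using L2_inner_integrable[OF f wce_op_L2(1)[OF cond_sq_bounded_cnj[OF z] cond_sq_bounded_cnj[OF v] g]]
    unfolding r .
  then have "L2_inner M f (?T' g) = (\<integral>x. ccond_exp M F \<psi> x * ccond_exp M F \<phi> x \<partial>M)"
    unfolding L2_inner_def r using fin by (intro integral_mult_ccond_exp) auto
  with L show ?B by (simp add: mult.commute)
qed

lemma wce_op_adjoint:
  assumes v: "cond_sq_bounded M F v C" and z: "cond_sq_bounded M F z D"
  shows "L2_adjoint M (wce_op M F v z) (wce_op M F (\<lambda>x. cnj (z x)) (\<lambda>x. cnj (v x)))"
  unfolding L2_adjoint_def
  using wce_op_bounded_op[OF cond_sq_bounded_cnj[OF z] cond_sq_bounded_cnj[OF v]] wce_op_inner(2)[OF v z]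
  by blast

text \<open>The inner expectation is \<open>F\<close>-measurable and leaves the outer one, so
  composing two such operators only inserts the coefficient \<open>E(z v')\<close>.\<close>

lemma wce_op_comp:
  assumes z: "cond_sq_bounded M F z D" and v': "cond_sq_bounded M F v' C'"
  shows "AE x in M. wce_op M F v z (wce_op M F v' z' f) x
    = v x * ccond_exp M F (\<lambda>y. z y * v' y) x * ccond_exp M F (\<lambda>y. z' y * f y) x"
proof -
  have [measurable]: "z \<in> borel_measurable M" "v' \<in> borel_measurable M"
    using z v' by (auto simp: cond_sq_bounded_def)
  have eq: "(\<lambda>y. z y * wce_op M F v' z' f y) = (\<lambda>y. ccond_exp M F (\<lambda>y. z' y * f y) y * (z y * v' y))"
    by (simp add: wce_op_def mult_ac)
  have "AE x in M. nn_cond_exp M F (\<lambda>y. ennreal (cmod (z y * v' y))) x < \<infinity> \<longrightarrow>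
      ccond_exp M F (\<lambda>y. ccond_exp M F (\<lambda>y. z' y * f y) y * (z y * v' y)) x
      = ccond_exp M F (\<lambda>y. z' y * f y) x * ccond_exp M F (\<lambda>y. z y * v' y) x"
    by (rule ccond_exp_pull_out) measurable
  moreover have "AE x in M. nn_cond_exp M F (\<lambda>y. ennreal (cmod (z y * v' y))) x < \<infinity>"
    using z v' by (intro nn_cond_exp_mult_finite cond_sq_bounded_measurable cond_sq_bounded_finite)
  ultimately show ?thesis
    by eventually_elim (subst wce_op_def, subst eq, simp add: mult_ac)
qed

end

context sigma_finite_subalgebra
begin

section \<open>Conditional second moments: scaling and supports\<close>

lemma cond_sq_mult:
  assumes [measurable]: "c \<in> borel_measurable F" "v \<in> borel_measurable M"
  shows "AE x in M. cond_sq M F (\<lambda>y. c y * v y) x = ennreal ((cmod (c x))\<^sup>2) * cond_sq M F v x"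
proof -
  have "AE x in M. ennreal ((cmod (c x))\<^sup>2) * nn_cond_exp M F (\<lambda>y. ennreal ((cmod (v y))\<^sup>2)) x
      = nn_cond_exp M F (\<lambda>y. ennreal ((cmod (c y))\<^sup>2) * ennreal ((cmod (v y))\<^sup>2)) x"
    by (rule nn_cond_exp_prod) measurable
  then show ?thesis
    by eventually_elim (simp add: cond_sq_def norm_mult power_mult_distrib ennreal_mult)
qed

lemma cond_sq_bounded_mult:
  assumes c [measurable]: "c \<in> borel_measurable F" and v: "cond_sq_bounded M F v C"
    and B: "B > 0" "\<And>x. cmod (c x) \<le> B"
  shows "cond_sq_bounded M F (\<lambda>y. c y * v y) (B\<^sup>2 * C)"
proof -
  have [measurable]: "v \<in> borel_measurable M" "c \<in> borel_measurable M"
    using v measurable_from_subalg[OF subalg c] by (auto simp: cond_sq_bounded_def)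
  have C: "C > 0" and vC: "AE x in M. cond_sq M F v x \<le> ennreal C"
    using v by (auto simp: cond_sq_bounded_def)
  have "AE x in M. cond_sq M F (\<lambda>y. c y * v y) x = ennreal ((cmod (c x))\<^sup>2) * cond_sq M F v x"
    by (rule cond_sq_mult) measurable
  with vC have "AE x in M. cond_sq M F (\<lambda>y. c y * v y) x \<le> ennreal (B\<^sup>2 * C)"
  proof eventually_elim
    case (elim x)
    have "ennreal ((cmod (c x))\<^sup>2) * cond_sq M F v x \<le> ennreal (B\<^sup>2) * ennreal C"
      using B by (intro mult_mono ennreal_leI power_mono elim) auto
    then show ?case using elim C by (simp add: ennreal_mult)
  qed
  moreover have "(\<lambda>y. c y * v y) \<in> borel_measurable M" by measurable
  ultimately show ?thesis using B C by (simp add: cond_sq_bounded_def)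
qed

text \<open>In the integral of \<open>|h|\<^sup>2 |v|\<^sup>2\<close> the second factor can be
  averaged. Hence \<open>h\<close> vanishes on the support of \<open>E(|v|\<^sup>2)\<close>, which
  can be larger than that of \<open>v\<close>; this is what determines the kernels.\<close>

lemma mult_eq_0_imp_factor_eq_0:
  assumes [measurable]: "h \<in> borel_measurable F" "v \<in> borel_measurable M"
    and 0: "AE x in M. v x * h x = 0"
  shows "AE x in M. cond_sq M F v x \<noteq> 0 \<longrightarrow> h x = 0"
proof -
  have [measurable]: "h \<in> borel_measurable M" by (rule measurable_from_subalg[OF subalg]) measurable
  have "(\<integral>\<^sup>+x. ennreal ((cmod (h x))\<^sup>2) * cond_sq M F v x \<partial>M)
      = (\<integral>\<^sup>+x. ennreal ((cmod (h x))\<^sup>2) * ennreal ((cmod (v x))\<^sup>2) \<partial>M)"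
    unfolding cond_sq_def by (rule nn_cond_exp_intg) measurable
  also have "\<dots> = (\<integral>\<^sup>+x. 0 \<partial>M)"
    using 0 by (intro nn_integral_cong_AE) (auto elim!: eventually_mono)
  also have "\<dots> = 0" by simp
  finally have "AE x in M. ennreal ((cmod (h x))\<^sup>2) * cond_sq M F v x = 0"
    by (subst (asm) nn_integral_0_iff_AE) simp_all
  then show ?thesis by eventually_elim auto
qed

text \<open>The set where \<open>E(|v|\<^sup>2)\<close> vanishes is itself in \<open>F\<close>, so
  \<open>|v|\<^sup>2\<close> has integral 0 over it.\<close>

lemma zero_where_cond_sq_zero:
  assumes [measurable]: "v \<in> borel_measurable M"
  shows "AE x in M. cond_sq M F v x = 0 \<longrightarrow> v x = 0"
proof -
  let ?Z = "\<lambda>x. if cond_sq M F v x = 0 then 1 else 0 :: ennreal"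
  have "(\<integral>\<^sup>+x. ?Z x * ennreal ((cmod (v x))\<^sup>2) \<partial>M) = (\<integral>\<^sup>+x. ?Z x * cond_sq M F v x \<partial>M)"
    unfolding cond_sq_def[of _ _ v] by (rule nn_cond_exp_intg[symmetric]) measurable
  also have "\<dots> = (\<integral>\<^sup>+x. 0 \<partial>M)" by (intro nn_integral_cong) auto
  also have "\<dots> = 0" by simp
  finally have "AE x in M. ?Z x * ennreal ((cmod (v x))\<^sup>2) = 0"
    by (subst (asm) nn_integral_0_iff_AE) simp_all
  then show ?thesis by eventually_elim auto
qed

lemma ccond_exp_mult_cnj:
  assumes v: "cond_sq_bounded M F v C"
  shows "AE x in M. ccond_exp M F (\<lambda>y. v y * cnj (v y)) x = complex_of_real (enn2real (cond_sq M F v x))"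
  unfolding complex_norm_square[symmetric] cond_sq_def of_real_power[symmetric]
proof (rule ccond_exp_of_real)
  have [measurable]: "v \<in> borel_measurable M" by (rule cond_sq_bounded_measurable[OF v])
  show "(\<lambda>y. (cmod (v y))\<^sup>2) \<in> borel_measurable M" by measurable
  show "AE x in M. nn_cond_exp M F (\<lambda>y. ennreal ((cmod (v y))\<^sup>2)) x < \<infinity>"
    using cond_sq_bounded_finite[OF v] by (simp add: cond_sq_def)
qed simp

lemma L2_mult_bounded:
  assumes [measurable]: "c \<in> borel_measurable M" and c: "\<And>x. cmod (c x) \<le> B" and f: "f \<in> L2 M"
  shows "(\<lambda>x. c x * f x) \<in> L2 M"
proof (rule L2_I)
  have [measurable]: "f \<in> borel_measurable M" by (rule L2_measurable[OF f])
  show "(\<lambda>x. c x * f x) \<in> borel_measurable M" by measurable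
  have "integrable M (\<lambda>x. B\<^sup>2 * (cmod (f x))\<^sup>2)" using L2_integrable[OF f] by simp
  then show "integrable M (\<lambda>x. (cmod (c x * f x))\<^sup>2)"
  proof (rule Bochner_Integration.integrable_bound)
    have "(cmod (c x * f x))\<^sup>2 \<le> B\<^sup>2 * (cmod (f x))\<^sup>2" for x
      using c[of x] by (auto simp: norm_mult power_mult_distrib intro!: mult_right_mono power_mono)
    then show "AE x in M. norm ((cmod (c x * f x))\<^sup>2) \<le> norm (B\<^sup>2 * (cmod (f x))\<^sup>2)" by simp
  qed measurable
qed

end

text \<open>The normal form \<open>T = M\<^bsub>a v\<^esub> E M\<^sub>z\<close> with \<open>E(|v|\<^sup>2) = E(|z|\<^sup>2) = \<chi>\<^sub>K\<close> and \<open>a\<close> an \<open>F\<close>-measurable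
  function, positive exactly on \<open>K\<close>.\<close>

locale normalized_wce = sigma_finite_subalgebra +
  fixes K :: "'a set" and v z :: "'a \<Rightarrow> complex" and a :: "'a \<Rightarrow> real" and B :: real
  assumes v: "v \<in> borel_measurable M" "AE x in M. cond_sq M F v x = indicator K x"
    and z: "z \<in> borel_measurable M" "AE x in M. cond_sq M F z x = indicator K x"
    and z_outside: "\<And>x. x \<notin> K \<Longrightarrow> z x = 0"
    and K: "K \<in> sets F"
    and a_measurable [measurable]: "a \<in> borel_measurable F"
    and a_nonneg: "\<And>x. 0 \<le> a x" and a_le: "\<And>x. a x \<le> B"
    and a_pos_iff: "\<And>x. 0 < a x \<longleftrightarrow> x \<in> K"
begin

abbreviation "Ez f \<equiv> ccond_exp M F (\<lambda>y. z y * f y)"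
abbreviation "Top \<equiv> wce_op M F (\<lambda>x. complex_of_real (a x) * v x) z"
abbreviation "Pop \<equiv> wce_op M F (\<lambda>x. complex_of_real (a x) * cnj (z x)) z"
abbreviation "Uop \<equiv> wce_op M F v z"
text \<open>The orthogonal projection onto the complement of the common kernel; a.e. it is the
  adjoint of \<open>Uop\<close> composed with \<open>Uop\<close>.\<close>

abbreviation "Qop \<equiv> wce_op M F (\<lambda>x. cnj (z x)) z"

lemma measurable_M [measurable]:
  "v \<in> borel_measurable M" "z \<in> borel_measurable M" "a \<in> borel_measurable M"
  using v z measurable_from_subalg[OF subalg a_measurable] by auto

lemma a_zero: "x \<notin> K \<Longrightarrow> a x = 0"
  using a_pos_iff[of x] a_nonneg[of x] by auto

lemma cond_sq_bounded_normalized: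
  assumes "c \<in> borel_measurable M" "AE x in M. cond_sq M F c x = indicator K x"
  shows "cond_sq_bounded M F c 1"
proof -
  have "AE x in M. cond_sq M F c x \<le> ennreal 1"
    using assms(2) by eventually_elim (simp add: indicator_def)
  with assms(1) show ?thesis by (simp add: cond_sq_bounded_def)
qed

lemmas bv = cond_sq_bounded_normalized[OF v] and bz = cond_sq_bounded_normalized[OF z]
lemmas bz' = cond_sq_bounded_cnj[OF bz] and bv' = cond_sq_bounded_cnj[OF bv]

text \<open>\<open>B = 0\<close> is possible when \<open>K\<close> is empty, while scaling asks for
  a positive bound; hence the maximum with 1.\<close>

lemma cond_sq_bounded_scaled:
  assumes "cond_sq_bounded M F c 1"
  shows "cond_sq_bounded M F (\<lambda>x. complex_of_real (a x) * c x) ((max B 1)\<^sup>2 * 1)"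
  using assms a_nonneg a_le by (intro cond_sq_bounded_mult) (auto simp: max.coboundedI1)

lemmas bav = cond_sq_bounded_scaled[OF bv] and baz' = cond_sq_bounded_scaled[OF bz']

lemma E_normalized:
  "AE x in M. ccond_exp M F (\<lambda>y. v y * cnj (v y)) x = indicator K x"
  "AE x in M. ccond_exp M F (\<lambda>y. z y * cnj (z y)) x = indicator K x"
proof -
  show "AE x in M. ccond_exp M F (\<lambda>y. v y * cnj (v y)) x = indicator K x"
    using ccond_exp_mult_cnj[OF bv] v(2) by eventually_elim (auto simp: indicator_def)
  show "AE x in M. ccond_exp M F (\<lambda>y. z y * cnj (z y)) x = indicator K x"
    using ccond_exp_mult_cnj[OF bz] z(2) by eventually_elim (auto simp: indicator_def)
qed

lemma E_normalized_scaled: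
  assumes [measurable]: "c \<in> borel_measurable F" and p: "cond_sq_bounded M F p 1"
    and E: "AE x in M. ccond_exp M F (\<lambda>y. p y * cnj (p y)) x = indicator K x"
  shows "AE x in M. ccond_exp M F (\<lambda>y. c y * (p y * cnj (p y))) x = c x * indicator K x"
proof -
  have [measurable]: "p \<in> borel_measurable M" by (rule cond_sq_bounded_measurable[OF p])
  have "AE x in M. nn_cond_exp M F (\<lambda>y. ennreal (cmod (p y * cnj (p y)))) x < \<infinity> \<longrightarrow>
      ccond_exp M F (\<lambda>y. c y * (p y * cnj (p y))) x = c x * ccond_exp M F (\<lambda>y. p y * cnj (p y)) x"
    by (rule ccond_exp_pull_out) measurable
  moreover have "AE x in M. nn_cond_exp M F (\<lambda>y. ennreal (cmod (p y * cnj (p y)))) x < \<infinity>"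
    using p cond_sq_bounded_cnj[OF p]
    by (intro nn_cond_exp_mult_finite cond_sq_bounded_measurable cond_sq_bounded_finite)
  ultimately show ?thesis using E by eventually_elim simp
qed

lemma E_az_cnj_z:
  "AE x in M. Ez (\<lambda>y. complex_of_real (a y) * cnj (z y)) x = complex_of_real (a x) * indicator K x"
proof -
  have eq: "(\<lambda>y. z y * (complex_of_real (a y) * cnj (z y))) = (\<lambda>y. complex_of_real (a y) * (z y * cnj (z y)))"
    by (simp add: mult_ac)
  show ?thesis unfolding eq by (rule E_normalized_scaled[OF _ bz E_normalized(2)]) measurable
qed

lemma E_cnj_av_av:
  "AE x in M. ccond_exp M F (\<lambda>y. cnj (complex_of_real (a y) * v y) * (complex_of_real (a y) * v y)) x
    = complex_of_real ((a x)\<^sup>2) * indicator K x"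
proof -
  have eq: "(\<lambda>y. cnj (complex_of_real (a y) * v y) * (complex_of_real (a y) * v y))
      = (\<lambda>y. complex_of_real ((a y)\<^sup>2) * (v y * cnj (v y)))"
    by (simp add: power2_eq_square mult_ac)
  show ?thesis unfolding eq by (rule E_normalized_scaled[OF _ bv E_normalized(1)]) measurable
qed

text \<open>Since \<open>z\<close> vanishes off \<open>K\<close>, multiplying by the indicator of
  \<open>K\<close> changes nothing, and this indicator is \<open>F\<close>-measurable and comes out
  of \<open>E\<close>.\<close>

lemma Ez_outside:
  assumes f: "f \<in> L2 M" shows "AE x in M. x \<notin> K \<longrightarrow> Ez f x = 0"
proof -
  have [measurable]: "f \<in> borel_measurable M" "K \<in> sets F" using f K by (auto simp: L2_def)
  have eq: "(\<lambda>y. indicator K y * (z y * f y)) = (\<lambda>y. z y * f y)"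
  proof
    fix y show "indicator K y * (z y * f y) = z y * f y"
      using z_outside[of y] by (cases "y \<in> K") simp_all
  qed
  have "AE x in M. nn_cond_exp M F (\<lambda>y. ennreal (cmod (z y * f y))) x < \<infinity> \<longrightarrow>
      ccond_exp M F (\<lambda>y. indicator K y * (z y * f y)) x = indicator K x * Ez f x"
    by (rule ccond_exp_pull_out) measurable
  with nn_cond_exp_mult_L2_finite[OF bz f] show ?thesis
    unfolding eq by eventually_elim (auto simp: indicator_def)
qed

text \<open>On \<open>K\<close> the factor \<open>c E(z f)\<close> must vanish because
  \<open>E(|p|\<^sup>2) = 1\<close> there, and off \<open>K\<close> already \<open>E(z f)\<close>
  does. One argument thus identifies all three kernels.\<close>

lemma ker_iff:
  assumes c: "c \<in> borel_measurable F" "\<And>x. x \<in> K \<Longrightarrow> c x \<noteq> 0"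
    and p: "p \<in> borel_measurable M" "AE x in M. cond_sq M F p x = indicator K x" and f: "f \<in> L2 M"
  shows "(AE x in M. wce_op M F (\<lambda>x. c x * p x) z f x = 0) \<longleftrightarrow> (AE x in M. Ez f x = 0)"
proof
  assume "AE x in M. wce_op M F (\<lambda>x. c x * p x) z f x = 0"
  then have "AE x in M. p x * (c x * Ez f x) = 0" by eventually_elim (auto simp: wce_op_def)
  moreover note [measurable] = c(1) p(1)
  have "(\<lambda>x. c x * Ez f x) \<in> borel_measurable F" by measurable
  ultimately have "AE x in M. cond_sq M F p x \<noteq> 0 \<longrightarrow> c x * Ez f x = 0"
    by (intro mult_eq_0_imp_factor_eq_0 p)
  with p(2) Ez_outside[OF f] show "AE x in M. Ez f x = 0"
    by eventually_elim (auto simp: indicator_def c split: if_splits)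
qed (auto elim!: eventually_mono simp: wce_op_def)

lemma kernels:
  "L2_ker M Uop = {f \<in> L2 M. AE x in M. Ez f x = 0}"
  "L2_ker M Pop = {f \<in> L2 M. AE x in M. Ez f x = 0}"
  "L2_ker M Top = {f \<in> L2 M. AE x in M. Ez f x = 0}"
proof -
  have z': "(\<lambda>x. cnj (z x)) \<in> borel_measurable M" "AE x in M. cond_sq M F (\<lambda>x. cnj (z x)) x = indicator K x"
    using z(2) by (measurable, simp add: cond_sq_def)
  have a: "(\<lambda>x. complex_of_real (a x)) \<in> borel_measurable F" "\<And>x. x \<in> K \<Longrightarrow> complex_of_real (a x) \<noteq> 0"
    using a_pos_iff by (measurable, force)
  show "L2_ker M Uop = {f \<in> L2 M. AE x in M. Ez f x = 0}"
    unfolding L2_ker_def using ker_iff[of "\<lambda>_. 1" v] v by (intro Collect_cong conj_cong) auto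
  show "L2_ker M Pop = {f \<in> L2 M. AE x in M. Ez f x = 0}"
    unfolding L2_ker_def using ker_iff[OF a z'] by (intro Collect_cong conj_cong) auto
  show "L2_ker M Top = {f \<in> L2 M. AE x in M. Ez f x = 0}"
    unfolding L2_ker_def using ker_iff[OF a v] by (intro Collect_cong conj_cong) auto
qed

lemma Uop_Qop:
  assumes f: "f \<in> L2 M" shows "AE x in M. Uop (Qop f) x = Uop f x"
  using wce_op_comp[OF bz bz', of v z f] E_normalized(2) Ez_outside[OF f]
  by eventually_elim (auto simp: wce_op_def indicator_def)

text \<open>The splitting of \<open>f\<close> into \<open>Qop f\<close> and a kernel element, used
  both for the isometry property and for density.\<close>

lemma diff_Qop_in_ker:
  assumes f: "f \<in> L2 M" shows "(\<lambda>x. f x - Qop f x) \<in> L2_ker M Uop"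
proof -
  have Q: "Qop f \<in> L2 M" by (rule wce_op_L2(1)[OF bz' bz f])
  have "AE x in M. Uop (\<lambda>x. f x - Qop f x) x = 0"
    using L2_bounded_op_diff[OF wce_op_bounded_op[OF bv bz] f Q] Uop_Qop[OF f]
    by eventually_elim simp
  with L2_diff[OF f Q] show ?thesis by (simp add: L2_ker_def)
qed

text \<open>The pairing \<open>\<langle>P f, f\<rangle>\<close> equals the integral of
  \<open>a |E(z f)|\<^sup>2\<close>, and \<open>a\<close> is nonnegative.\<close>

lemma Pop_positive: "L2_positive M Pop"
  unfolding L2_positive_def
proof (intro conjI ballI)
  show "L2_bounded_op M Pop" by (rule wce_op_bounded_op[OF baz' bz])
  fix f assume f: "f \<in> L2 M"
  have [measurable]: "f \<in> borel_measurable M" by (rule L2_measurable[OF f])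
  have "AE x in M. nn_cond_exp M F (\<lambda>y. ennreal (cmod (cnj (z y * f y)))) x < \<infinity> \<longrightarrow>
    ccond_exp M F (\<lambda>y. complex_of_real (a y) * cnj (z y * f y)) x
      = complex_of_real (a x) * ccond_exp M F (\<lambda>y. cnj (z y * f y)) x"
    by (rule ccond_exp_pull_out) measurable
  then have E: "AE x in M. Ez f x * ccond_exp M F (\<lambda>y. complex_of_real (a y) * cnj (z y) * cnj (f y)) x
      = complex_of_real (a x * (cmod (Ez f x))\<^sup>2)"
    using nn_cond_exp_mult_L2_finite[OF bz f]
  proof eventually_elim
    case (elim x)
    have "ccond_exp M F (\<lambda>y. complex_of_real (a y) * cnj (z y) * cnj (f y)) x = complex_of_real (a x) * cnj (Ez f x)"
      using elim(1)[rule_format, unfolded complex_mod_cnj, OF elim(2)] ccond_exp_cnj[of "\<lambda>y. z y * f y" x]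
      by (simp add: mult.assoc)
    then show ?case using complex_norm_square[of "Ez f x"] by (simp add: mult_ac)
  qed
  have "L2_inner M (Pop f) f = (\<integral>x. complex_of_real (a x * (cmod (Ez f x))\<^sup>2) \<partial>M)"
    unfolding wce_op_inner(1)[OF baz' bz f f]
    by (rule integral_cong_AE[OF _ _ E]) measurable
  also have "\<dots> = complex_of_real (\<integral>x. a x * (cmod (Ez f x))\<^sup>2 \<partial>M)" by (rule integral_complex_of_real)
  finally show "L2_inner M (Pop f) f \<in> \<real>\<^sub>\<ge>\<^sub>0"
    using a_nonneg by (auto intro!: integral_nonneg)
qed

text \<open>\<open>P\<^sup>2\<close> and the adjoint of \<open>T\<close> composed with
  \<open>T\<close> both reduce to \<open>a\<^sup>2 cnj z E(z f)\<close> on \<open>K\<close>, the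
  first through \<open>E(|z|\<^sup>2)\<close> and the second through
  \<open>E(|v|\<^sup>2)\<close>.\<close>

lemma Pop_abs: "L2_abs_op M Top Pop"
proof -
  let ?T' = "wce_op M F (\<lambda>x. cnj (z x)) (\<lambda>x. cnj (complex_of_real (a x) * v x))"
  have "AE x in M. Pop (Pop f) x = ?T' (Top f) x" if "f \<in> L2 M" for f
    using wce_op_comp[OF bz baz', of "\<lambda>x. complex_of_real (a x) * cnj (z x)" z f] E_az_cnj_z
      wce_op_comp[OF cond_sq_bounded_cnj[OF bav] bav, of "\<lambda>x. cnj (z x)" z f] E_cnj_av_av
  proof eventually_elim
    case (elim x)
    show ?case unfolding elim(1,3) unfolding elim(2,4) by (simp add: power2_eq_square)
  qed
  then have "L2_op_eq M (Pop \<circ> Pop) (?T' \<circ> Top)" by (simp add: L2_op_eq_def)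
  with wce_op_adjoint[OF bav bz] Pop_positive show ?thesis
    unfolding L2_abs_op_def L2_pos_sqrt_def by blast
qed

text \<open>Orthogonality to the kernel element \<open>f - Qop f\<close> gives
  \<open>\<langle>f, f\<rangle> = \<langle>f, Qop f\<rangle>\<close>; writing \<open>Qop\<close> as
  adjoint times \<open>Uop\<close> turns the right-hand side into the squared norm of
  \<open>Uop f\<close>.\<close>

lemma Uop_partial_isometry: "L2_partial_isometry M Uop"
  unfolding L2_partial_isometry_def
proof (intro conjI ballI impI)
  show "L2_bounded_op M Uop" by (rule wce_op_bounded_op[OF bv bz])
  fix f assume f: "f \<in> L2 M" and perp: "\<forall>g\<in>L2_ker M Uop. L2_inner M f g = 0"
  have Q: "Qop f \<in> L2 M" and U: "Uop f \<in> L2 M"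
    by (rule wce_op_L2(1)[OF bz' bz f], rule wce_op_L2(1)[OF bv bz f])
  let ?k = "\<lambda>x. f x - Qop f x"
  have k: "?k \<in> L2 M" using f Q by (rule L2_diff)
  have "L2_inner M f ?k = 0" using perp diff_Qop_in_ker[OF f] by blast
  moreover have "L2_inner M f (\<lambda>x. ?k x + Qop f x) = L2_inner M f ?k + L2_inner M f (Qop f)"
    by (rule L2_inner_add_right[OF k Q f])
  ultimately have "L2_inner M f f = L2_inner M f (Qop f)" by simp
  also have "\<dots> = L2_inner M f (wce_op M F (\<lambda>x. cnj (z x)) (\<lambda>x. cnj (v x)) (Uop f))"
  proof (rule L2_inner_cong_AE)
    have eq: "(\<lambda>y. cnj (v y) * v y) = (\<lambda>y. v y * cnj (v y))" by (simp add: mult.commute)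
    show "AE x in M. Qop f x = wce_op M F (\<lambda>x. cnj (z x)) (\<lambda>x. cnj (v x)) (Uop f) x"
      using wce_op_comp[OF bv' bv, of "\<lambda>x. cnj (z x)" z f] E_normalized(1) Ez_outside[OF f]
      unfolding eq
    proof eventually_elim
      case (elim x)
      show ?case unfolding elim(1) unfolding elim(2) using elim(3)
        by (cases "x \<in> K") (simp_all add: wce_op_def)
    qed
  qed (use f Q in \<open>simp_all add: L2_measurable\<close>)
  also have "\<dots> = L2_inner M (Uop f) (Uop f)" by (rule wce_op_inner(2)[OF bv bz f U, symmetric])
  finally have "(L2_norm M (Uop f))\<^sup>2 = (L2_norm M f)\<^sup>2"
    unfolding L2_inner_self of_real_eq_iff by simp
  then show "L2_norm M (Uop f) = L2_norm M f" by simp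
qed

lemma Top_eq_Uop_Pop: "L2_op_eq M Top (Uop \<circ> Pop)"
  unfolding L2_op_eq_def
proof
  fix f assume f: "f \<in> L2 M"
  show "AE x in M. Top f x = (Uop \<circ> Pop) f x"
    using wce_op_comp[OF bz baz', of v z f] E_az_cnj_z
  proof eventually_elim
    case (elim x)
    show ?case unfolding comp_def elim(1) unfolding elim(2)
      by (cases "x \<in> K") (simp_all add: wce_op_def a_zero mult_ac)
  qed
qed

lemma polar_decomp: "L2_polar_decomp M Top Uop Pop"
  unfolding L2_polar_decomp_def
  using wce_op_bounded_op[OF bav bz] Pop_abs Uop_partial_isometry Top_eq_Uop_Pop kernels by simp

text \<open>\<open>P\<close> is inverted explicitly where \<open>a \<ge> 1/n\<close>.\<close>

lemma Pop_range_ker_dense: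
  assumes f: "f \<in> L2 M" and e: "0 < e"
  shows "\<exists>g\<in>L2 M. \<exists>k\<in>L2_ker M Pop. L2_norm M (\<lambda>x. f x - (Pop g x + k x)) < e"
proof -
  have [measurable]: "f \<in> borel_measurable M" by (rule L2_measurable[OF f])
  have Q: "Qop f \<in> L2 M" by (rule wce_op_L2(1)[OF bz' bz f])
  have [measurable]: "Qop f \<in> borel_measurable M" by (rule L2_measurable[OF Q])
  let ?k = "\<lambda>x. f x - Qop f x"
  have k: "?k \<in> L2_ker M Pop" using diff_Qop_in_ker[OF f] by (simp add: kernels)
  \<comment> \<open>\<open>1 / a\<close> may be unbounded, so it is cut off where \<open>a\<close>
    is small. With \<open>g = c f\<close> one gets \<open>Pop g = Qop f\<close> where
    \<open>a\<close> is at least \<open>1 / Suc n\<close> and 0 elsewhere, which leaves the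
    remainder \<open>r\<close>.\<close>
  define c where "c = (\<lambda>n x. complex_of_real (if 1 / real (Suc n) \<le> a x then 1 / a x else 0))"
  have cF [measurable]: "c n \<in> borel_measurable F" for n unfolding c_def by measurable
  have [measurable]: "c n \<in> borel_measurable M" for n by (rule measurable_from_subalg[OF subalg cF])
  have cle: "cmod (c n x) \<le> real (Suc n)" for n x
  proof (cases "1 / real (Suc n) \<le> a x")
    case True
    have "0 < 1 / real (Suc n)" by simp
    with True have "0 < a x" by linarith
    with True show ?thesis by (simp add: c_def norm_divide field_simps)
  qed (simp add: c_def)
  define g where "g = (\<lambda>n x. c n x * f x)"
  have g: "g n \<in> L2 M" for n unfolding g_def by (rule L2_mult_bounded[OF _ cle f]) measurable
  define r where "r = (\<lambda>n x. (if a x < 1 / real (Suc n) then Qop f x else 0))"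
  have [measurable]: "r n \<in> borel_measurable M" for n unfolding r_def by measurable
  have diff: "AE x in M. f x - (Pop (g n) x + ?k x) = r n x" for n
  proof -
    have eq: "(\<lambda>y. z y * g n y) = (\<lambda>y. c n y * (z y * f y))" by (simp add: g_def mult_ac)
    have "AE x in M. nn_cond_exp M F (\<lambda>y. ennreal (cmod (z y * f y))) x < \<infinity> \<longrightarrow>
        ccond_exp M F (\<lambda>y. c n y * (z y * f y)) x = c n x * Ez f x"
      by (rule ccond_exp_pull_out) measurable
    with nn_cond_exp_mult_L2_finite[OF bz f] show ?thesis
    proof eventually_elim
      case (elim x)
      have "0 < 1 / real (Suc n)" by simp
      then have "a x \<noteq> 0" if "1 / real (Suc n) \<le> a x" using that by linarith
      then have "complex_of_real (a x) * c n x = (if a x < 1 / real (Suc n) then 0 else 1)"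
        by (auto simp: c_def not_less)
      moreover have "Pop (g n) x = (complex_of_real (a x) * c n x) * Qop f x"
        unfolding wce_op_def eq using elim by (simp add: mult_ac)
      ultimately show ?case by (simp add: r_def)
    qed
  qed
  \<comment> \<open>Dominated by \<open>Qop f\<close>. At each point of \<open>K\<close> the
    remainder is eventually 0 because \<open>a > 0\<close> there; off \<open>K\<close> it is 0
    because \<open>z\<close> is.\<close>
  have "(\<lambda>n. \<integral>x. (cmod (r n x))\<^sup>2 \<partial>M) \<longlonglongrightarrow> (\<integral>x. 0 \<partial>M)"
  proof (rule integral_dominated_convergence[where w="\<lambda>x. (cmod (Qop f x))\<^sup>2"])
    show "integrable M (\<lambda>x. (cmod (Qop f x))\<^sup>2)" by (rule L2_integrable[OF Q])
    show "AE x in M. (\<lambda>n. (cmod (r n x))\<^sup>2) \<longlonglongrightarrow> 0"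
    proof (rule AE_I2)
      fix x
      have "\<forall>\<^sub>F n in sequentially. (cmod (r n x))\<^sup>2 = 0"
      proof (cases "x \<in> K")
        case True
        then have "0 < a x" by (simp add: a_pos_iff)
        have "(\<lambda>n. 1 / real (Suc n)) \<longlonglongrightarrow> 0" by (rule LIMSEQ_Suc[OF lim_1_over_n])
        then have "\<forall>\<^sub>F n in sequentially. 1 / real (Suc n) < a x"
          using \<open>0 < a x\<close> by (rule order_tendstoD)
        then show ?thesis by eventually_elim (simp add: r_def)
      next
        case False
        then show ?thesis by (simp add: r_def wce_op_def z_outside)
      qed
      then show "(\<lambda>n. (cmod (r n x))\<^sup>2) \<longlonglongrightarrow> 0" by (rule tendsto_eventually)
    qed
    show "AE x in M. norm ((cmod (r n x))\<^sup>2) \<le> (cmod (Qop f x))\<^sup>2" for n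
      by (rule AE_I2) (simp add: r_def)
  qed measurable
  then have "(\<lambda>n. L2_norm M (r n)) \<longlonglongrightarrow> 0"
    unfolding L2_norm_def using tendsto_real_sqrt by fastforce
  then have "\<forall>\<^sub>F n in sequentially. L2_norm M (r n) < e"
    using e by (rule order_tendstoD)
  then obtain n where n: "L2_norm M (r n) < e" by (auto simp: eventually_sequentially)
  have "Pop (g n) \<in> L2 M" by (rule wce_op_L2(1)[OF baz' bz g])
  then have [measurable]: "Pop (g n) \<in> borel_measurable M" by (rule L2_measurable)
  have "L2_norm M (\<lambda>x. f x - (Pop (g n) x + ?k x)) = L2_norm M (r n)"
    by (rule L2_norm_cong_AE[OF diff]) measurable
  with n k g show ?thesis by metis
qed

end

subsection \<open>Bounded weighted conditional expectation operators in normal form\<close>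

context sigma_finite_subalgebra
begin

text \<open>Sets of finite measure suffice since they exhaust the space; finiteness of the larger
  integral is what makes a strict inequality of integrals contradictory when functions may be
  infinite.\<close>

lemma AE_le_if_nn_integral_le:
  assumes [measurable]: "f \<in> borel_measurable F" "g \<in> borel_measurable F"
    and le: "\<And>D. D \<in> sets F \<Longrightarrow> emeasure M D < \<infinity> \<Longrightarrow>
      (\<integral>\<^sup>+x. indicator D x * g x \<partial>M) \<le> (\<integral>\<^sup>+x. indicator D x * f x \<partial>M)"
    and fin: "\<And>D. D \<in> sets F \<Longrightarrow> emeasure M D < \<infinity> \<Longrightarrow> (\<integral>\<^sup>+x. indicator D x * f x \<partial>M) < \<infinity>"
  shows "AE x in M. g x \<le> f x"
proof -
  have [measurable]: "f \<in> borel_measurable M" "g \<in> borel_measurable M"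
    by (rule measurable_from_subalg[OF subalg]; measurable)+
  interpret F: sigma_finite_measure "restr_to_subalg M F" by (rule sigma_fin_subalg)
  obtain D :: "nat \<Rightarrow> 'a set" where "range D \<subseteq> sets (restr_to_subalg M F)" "(\<Union>i. D i) = space (restr_to_subalg M F)"
    "\<And>i. emeasure (restr_to_subalg M F) (D i) \<noteq> \<infinity>"
    by (rule F.sigma_finite) blast
  then have D: "D i \<in> sets F" "(\<Union>i. D i) = space M" "emeasure (restr_to_subalg M F) (D i) < \<infinity>" for i
    using sets_restr_to_subalg[OF subalg]
    by (auto simp: space_restr_to_subalg less_top image_subset_iff)
  then have Dfin: "emeasure M (D i) < \<infinity>" for i
    using emeasure_restr_to_subalg[OF subalg D(1), of i] D(3)[of i] by simp
  have space: "space F = space M" using subalg by (simp add: subalgebra_def)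
  have "AE x in M. x \<in> D i \<longrightarrow> g x \<le> f x" for i
  proof -
    \<comment> \<open>If the inequality failed on a non-null part of \<open>D i\<close>, the
      integrals over \<open>H\<close> would be strictly ordered the wrong way.\<close>
    define H where "H = D i \<inter> {x \<in> space M. f x < g x}"
    have "{x \<in> space F. f x < g x} \<in> sets F" by measurable
    then have HF: "H \<in> sets F" using D(1)[of i] by (simp add: H_def space)
    then have HM [measurable]: "H \<in> sets M" using subalg by (auto simp: subalgebra_def)
    have "D i \<in> sets M" using D(1) subalg by (auto simp: subalgebra_def)
    then have "emeasure M H \<le> emeasure M (D i)" by (intro emeasure_mono) (auto simp: H_def)
    then have Hfin: "emeasure M H < \<infinity>" using Dfin by (rule le_less_trans)
    have "AE x in M. indicator H x * g x \<le> indicator H x * f x"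
    proof (rule ccontr)
      assume not_le: "\<not> ?thesis"
      have "(\<integral>\<^sup>+x. indicator H x * f x \<partial>M) < (\<integral>\<^sup>+x. indicator H x * g x \<partial>M)"
      proof (rule nn_integral_less)
        show "(\<integral>\<^sup>+x. indicator H x * f x \<partial>M) \<noteq> \<infinity>" using fin[OF HF Hfin] by simp
        show "AE x in M. indicator H x * f x \<le> indicator H x * g x"
          by (rule AE_I2) (auto simp: H_def indicator_def)
      qed (measurable, rule not_le)
      with le[OF HF Hfin] show False by simp
    qed
    then show ?thesis
      using AE_space
    proof eventually_elim
      case (elim x)
      then show ?case by (cases "f x < g x") (auto simp: H_def)
    qed
  qed
  then have "AE x in M. \<forall>i. x \<in> D i \<longrightarrow> g x \<le> f x" by (rule AE_all_countable[THEN iffD2, OF allI])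
  then show ?thesis using AE_space
  proof eventually_elim
    case (elim x)
    then obtain i where "x \<in> D i" using D(2) by blast
    with elim show ?case by blast
  qed
qed

text \<open>Boundedness is tested on \<open>f = \<chi>\<^sub>D \<chi>\<^bsub>{|u| \<le> n}\<^esub> cnj u\<close>, for which \<open>E(u f) = \<chi>\<^sub>D q\<^sub>n\<close> with \<open>q\<^sub>n\<close>
  the conditional expectation of the truncation of \<open>|u|\<^sup>2\<close>.\<close>

lemma wce_bounded_truncated:
  assumes [measurable]: "u \<in> borel_measurable M" "w \<in> borel_measurable M"
    and L2: "\<And>f. f \<in> L2 M \<Longrightarrow> wce_op M F w u f \<in> L2 M"
    and C: "C > 0" "\<And>f. f \<in> L2 M \<Longrightarrow> L2_norm M (wce_op M F w u f) \<le> C * L2_norm M f"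
  defines "h \<equiv> \<lambda>n::nat. \<lambda>x. if cmod (u x) \<le> real n then (cmod (u x))\<^sup>2 else 0"
  shows "AE x in M. cond_sq M F w x * nn_cond_exp M F (\<lambda>y. ennreal (h n y)) x \<le> ennreal (C\<^sup>2)"
proof -
  have [measurable]: "h n \<in> borel_measurable M" unfolding h_def by measurable
  have h0: "0 \<le> h n x" for x by (simp add: h_def)
  have hn: "h n x \<le> (real n)\<^sup>2" for x by (auto simp: h_def intro: power_mono)
  let ?q = "nn_cond_exp M F (\<lambda>y. ennreal (h n y))"
  have "AE x in M. ?q x \<le> nn_cond_exp M F (\<lambda>y. ennreal ((real n)\<^sup>2)) x"
    by (rule nn_cond_exp_real_mono[OF _ _ hn]) measurable
  moreover have "AE x in M. ennreal ((real n)\<^sup>2) = nn_cond_exp M F (\<lambda>y. ennreal ((real n)\<^sup>2)) x"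
    by (rule nn_cond_exp_F_meas) measurable
  ultimately have qn: "AE x in M. ?q x \<le> ennreal ((real n)\<^sup>2)" by eventually_elim simp
  \<comment> \<open>Integrated over \<open>D\<close>, the left side is the squared norm of
    \<open>T f\<close> for the test function \<open>f\<close>, and the right side is
    \<open>C\<^sup>2\<close> times that of \<open>f\<close>.\<close>
  have main: "AE x in M. cond_sq M F w x * (?q x)\<^sup>2 \<le> ennreal (C\<^sup>2) * ?q x"
  proof (rule AE_le_if_nn_integral_le)
    fix D assume D: "D \<in> sets F" and Dfin: "emeasure M D < \<infinity>"
    have [measurable]: "D \<in> sets M" "D \<in> sets F" using D subalg by (auto simp: subalgebra_def)
    have "(\<integral>\<^sup>+x. indicator D x * (ennreal (C\<^sup>2) * ?q x) \<partial>M)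
        \<le> (\<integral>\<^sup>+x. ennreal (C\<^sup>2 * (real n)\<^sup>2) * indicator D x \<partial>M)"
      using qn by (intro nn_integral_mono_AE)
        (auto simp: indicator_def ennreal_mult intro!: mult_left_mono elim!: eventually_mono)
    also have "\<dots> = ennreal (C\<^sup>2 * (real n)\<^sup>2) * emeasure M D" by (rule nn_integral_cmult_indicator) measurable
    also have "\<dots> < \<infinity>" using Dfin by (simp add: ennreal_mult_less_top)
    finally show "(\<integral>\<^sup>+x. indicator D x * (ennreal (C\<^sup>2) * ?q x) \<partial>M) < \<infinity>" .
    \<comment> \<open>Bounded by \<open>n\<close> and supported in a set of finite measure, hence in
      \<open>L2 M\<close>, although \<open>u\<close> need not be.\<close>
    define f where "f = (\<lambda>x. if x \<in> D \<and> cmod (u x) \<le> real n then cnj (u x) else 0)"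
    have [measurable]: "f \<in> borel_measurable M" unfolding f_def by measurable
    have fsq: "(cmod (f x))\<^sup>2 = indicator D x * h n x" for x by (auto simp: f_def h_def indicator_def)
    have f: "f \<in> L2 M"
    proof (rule L2_I)
      have "integrable M (\<lambda>x. (real n)\<^sup>2 * indicator D x :: real)"
        using Dfin by (intro integrable_mult_right) (simp add: less_top)
      then show "integrable M (\<lambda>x. (cmod (f x))\<^sup>2)"
        by (rule Bochner_Integration.integrable_bound) (use hn h0 in \<open>auto simp: fsq indicator_def\<close>)
    qed measurable
    have uf: "(\<lambda>y. u y * f y) = (\<lambda>y. indicator D y * complex_of_real (h n y))"
      by (auto simp: f_def h_def indicator_def complex_norm_square[symmetric] simp del: of_real_power)
    have hfin: "AE x in M. nn_cond_exp M F (\<lambda>y. ennreal (h n y)) x < \<infinity>"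
      using qn by eventually_elim (auto intro: le_less_trans)
    have "AE x in M. nn_cond_exp M F (\<lambda>y. ennreal (cmod (complex_of_real (h n y)))) x < \<infinity> \<longrightarrow>
       ccond_exp M F (\<lambda>y. indicator D y * complex_of_real (h n y)) x
         = indicator D x * ccond_exp M F (\<lambda>y. complex_of_real (h n y)) x"
      by (rule ccond_exp_pull_out) measurable
    moreover have "AE x in M. ccond_exp M F (\<lambda>y. complex_of_real (h n y)) x = complex_of_real (enn2real (?q x))"
      using h0 hfin by (intro ccond_exp_of_real) auto
    ultimately have Euf: "AE x in M. ccond_exp M F (\<lambda>y. u y * f y) x = indicator D x * complex_of_real (enn2real (?q x))"
      using hfin unfolding uf by eventually_elim (simp add: h0)
    let ?T = "wce_op M F w u f"
    have "(\<integral>\<^sup>+x. indicator D x * (cond_sq M F w x * (?q x)\<^sup>2) \<partial>M)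
        = (\<integral>\<^sup>+x. (indicator D x * (?q x)\<^sup>2) * cond_sq M F w x \<partial>M)"
      by (simp add: mult_ac)
    also have "\<dots> = (\<integral>\<^sup>+x. (indicator D x * (?q x)\<^sup>2) * ennreal ((cmod (w x))\<^sup>2) \<partial>M)"
      unfolding cond_sq_def by (rule nn_cond_exp_intg) measurable
    also have "\<dots> = (\<integral>\<^sup>+x. ennreal ((cmod (?T x))\<^sup>2) \<partial>M)"
    proof (rule nn_integral_cong_AE)
      show "AE x in M. (indicator D x * (?q x)\<^sup>2) * ennreal ((cmod (w x))\<^sup>2) = ennreal ((cmod (?T x))\<^sup>2)"
        using Euf hfin
      proof eventually_elim
        case (elim x)
        obtain r where r: "?q x = ennreal r" "r \<ge> 0" using elim(2) by (cases "?q x") auto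
        show ?case
          unfolding wce_op_def elim(1) using r
          by (auto simp: indicator_def norm_mult power_mult_distrib ennreal_mult ennreal_power mult.commute)
      qed
    qed
    also have "\<dots> = ennreal ((L2_norm M ?T)\<^sup>2)" by (rule L2_nn_integral[OF L2[OF f]])
    also have "\<dots> \<le> ennreal ((C * L2_norm M f)\<^sup>2)" by (intro ennreal_leI power_mono C(2)[OF f]) simp
    also have "\<dots> = ennreal (C\<^sup>2) * ennreal ((L2_norm M f)\<^sup>2)" by (simp add: power_mult_distrib ennreal_mult)
    also have "ennreal ((L2_norm M f)\<^sup>2) = (\<integral>\<^sup>+x. indicator D x * ennreal (h n x) \<partial>M)"
      unfolding L2_nn_integral[OF f, symmetric] fsq by (intro nn_integral_cong) (simp add: indicator_def)
    also have "\<dots> = (\<integral>\<^sup>+x. indicator D x * ?q x \<partial>M)"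
      by (rule nn_cond_exp_intg[symmetric]) measurable
    also have "ennreal (C\<^sup>2) * \<dots> = (\<integral>\<^sup>+x. ennreal (C\<^sup>2) * (indicator D x * ?q x) \<partial>M)"
      by (rule nn_integral_cmult[symmetric]) measurable
    finally show "(\<integral>\<^sup>+x. indicator D x * (cond_sq M F w x * (?q x)\<^sup>2) \<partial>M)
        \<le> (\<integral>\<^sup>+x. indicator D x * (ennreal (C\<^sup>2) * ?q x) \<partial>M)"
      by (simp add: mult_ac)
  qed measurable
  show ?thesis
    using main qn
  proof eventually_elim
    case (elim x)
    obtain r where r: "?q x = ennreal r" "r \<ge> 0"
      using elim(2) by (cases "?q x") (auto simp: top_unique)
    show ?case
    proof (cases "r = 0")
      case False
      with r have "r > 0" by simp
      \<comment> \<open>Cancels one factor \<open>?q x\<close>, which truncation has made finite.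
        Multiplying by \<open>1 / r\<close> is safe even though \<open>cond_sq M F w x\<close> is
        not yet known to be finite.\<close>
      have "?q x = (?q x)\<^sup>2 * ennreal (1 / r)"
        using r \<open>r > 0\<close> by (simp add: power2_eq_square ennreal_mult[symmetric])
      then have "cond_sq M F w x * ?q x = (cond_sq M F w x * (?q x)\<^sup>2) * ennreal (1 / r)"
        by (simp only: mult.assoc)
      also have "\<dots> \<le> (ennreal (C\<^sup>2) * ?q x) * ennreal (1 / r)" by (intro mult_right_mono elim(1)) simp
      also have "\<dots> = ennreal (C\<^sup>2)"
        using r \<open>r > 0\<close> by (simp add: mult.assoc ennreal_mult[symmetric])
      finally show ?thesis .
    qed (simp add: r)
  qed
qed

text \<open>The truncated bound does not depend on \<open>n\<close>, so monotone convergence under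
  integrals over finite-measure sets removes the truncation. The resulting constant is the square of
  the operator bound.\<close>

lemma wce_bounded_imp_cond_sq_mult_le:
  assumes [measurable]: "u \<in> borel_measurable M" "w \<in> borel_measurable M"
    and bdd: "wce_bounded M F w u"
  obtains C where "C > 0" "AE x in M. cond_sq M F w x * cond_sq M F u x \<le> ennreal C"
proof -
  obtain C0 where C0: "\<And>f. f \<in> L2 M \<Longrightarrow> L2_norm M (wce_op M F w u f) \<le> C0 * L2_norm M f"
    using bdd unfolding wce_bounded_def by blast
  define C where "C = max C0 1"
  have "C > 0" by (simp add: C_def)
  have C: "L2_norm M (wce_op M F w u f) \<le> C * L2_norm M f" if "f \<in> L2 M" for f
    using C0[OF that] mult_right_mono[of C0 C "L2_norm M f"] by (simp add: C_def)
  have L2: "wce_op M F w u f \<in> L2 M" if "f \<in> L2 M" for f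
    using bdd that unfolding wce_bounded_def by blast
  define h where "h = (\<lambda>n::nat. \<lambda>x. if cmod (u x) \<le> real n then (cmod (u x))\<^sup>2 else 0)"
  have [measurable]: "h n \<in> borel_measurable M" for n unfolding h_def by measurable
  have trunc: "AE x in M. cond_sq M F w x * nn_cond_exp M F (\<lambda>y. ennreal (h n y)) x \<le> ennreal (C\<^sup>2)" for n
    unfolding h_def by (rule wce_bounded_truncated[OF assms(1,2) L2 \<open>C > 0\<close> C])
  have "AE x in M. cond_sq M F w x * cond_sq M F u x \<le> ennreal (C\<^sup>2)"
  proof (rule AE_le_if_nn_integral_le)
    fix D assume D: "D \<in> sets F" and Dfin: "emeasure M D < \<infinity>"
    have [measurable]: "D \<in> sets M" "D \<in> sets F" using D subalg by (auto simp: subalgebra_def)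
    have int: "(\<integral>\<^sup>+x. indicator D x * ennreal (C\<^sup>2) \<partial>M) = ennreal (C\<^sup>2) * emeasure M D"
      by (subst mult.commute) (rule nn_integral_cmult_indicator, measurable)
    then show "(\<integral>\<^sup>+x. indicator D x * ennreal (C\<^sup>2) \<partial>M) < \<infinity>"
      using Dfin by (simp add: ennreal_mult_less_top)
    let ?c = "\<lambda>x. indicator D x * cond_sq M F w x"
    have sup: "ennreal ((cmod (u x))\<^sup>2) = (SUP n. ennreal (h n x))" for x
    proof (rule antisym)
      obtain n where "cmod (u x) \<le> real n" using real_arch_simple by blast
      then have "ennreal ((cmod (u x))\<^sup>2) = ennreal (h n x)" by (simp add: h_def)
      then show "ennreal ((cmod (u x))\<^sup>2) \<le> (SUP n. ennreal (h n x))" by (auto intro: SUP_upper)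
      show "(SUP n. ennreal (h n x)) \<le> ennreal ((cmod (u x))\<^sup>2)"
        by (rule SUP_least) (auto simp: h_def)
    qed
    have "(\<integral>\<^sup>+x. indicator D x * (cond_sq M F w x * cond_sq M F u x) \<partial>M)
        = (\<integral>\<^sup>+x. ?c x * cond_sq M F u x \<partial>M)" by (simp add: mult_ac)
    also have "\<dots> = (\<integral>\<^sup>+x. ?c x * ennreal ((cmod (u x))\<^sup>2) \<partial>M)"
      unfolding cond_sq_def[of _ _ u] by (rule nn_cond_exp_intg) measurable
    also have "\<dots> = (\<integral>\<^sup>+x. (SUP n. ?c x * ennreal (h n x)) \<partial>M)"
      unfolding sup by (intro nn_integral_cong SUP_mult_left_ennreal)
    also have "\<dots> = (SUP n. \<integral>\<^sup>+x. ?c x * ennreal (h n x) \<partial>M)"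
    proof (rule nn_integral_monotone_convergence_SUP)
      show "incseq (\<lambda>n x. ?c x * ennreal (h n x))"
        by (rule monoI) (auto simp: le_fun_def h_def intro!: mult_left_mono)
    qed measurable
    also have "\<dots> \<le> (\<integral>\<^sup>+x. indicator D x * ennreal (C\<^sup>2) \<partial>M)"
    proof (rule SUP_least)
      fix n
      have "(\<integral>\<^sup>+x. ?c x * ennreal (h n x) \<partial>M) = (\<integral>\<^sup>+x. ?c x * nn_cond_exp M F (\<lambda>y. ennreal (h n y)) x \<partial>M)"
        by (rule nn_cond_exp_intg[symmetric]) measurable
      also have "\<dots> \<le> (\<integral>\<^sup>+x. indicator D x * ennreal (C\<^sup>2) \<partial>M)"
        using trunc[of n] by (intro nn_integral_mono_AE)
          (auto simp: indicator_def elim!: eventually_mono)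
      finally show "(\<integral>\<^sup>+x. ?c x * ennreal (h n x) \<partial>M) \<le> (\<integral>\<^sup>+x. indicator D x * ennreal (C\<^sup>2) \<partial>M)" .
    qed
    finally show "(\<integral>\<^sup>+x. indicator D x * (cond_sq M F w x * cond_sq M F u x) \<partial>M)
        \<le> (\<integral>\<^sup>+x. indicator D x * ennreal (C\<^sup>2) \<partial>M)" .
  qed measurable
  with \<open>C > 0\<close> show thesis by (intro that[of "C\<^sup>2"]) auto
qed

section \<open>Normalised weights\<close>

definition cond_normalize :: "'a set \<Rightarrow> ('a \<Rightarrow> complex) \<Rightarrow> 'a \<Rightarrow> complex" where
  "cond_normalize K g x =
     complex_of_real (if x \<in> K then 1 / sqrt (enn2real (cond_sq M F g x)) else 0) * g x"

lemma cond_sq_normalize: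
  assumes [measurable]: "g \<in> borel_measurable M" and K [measurable]: "K \<in> sets F"
    and pos: "\<And>x. x \<in> K \<Longrightarrow> 0 < cond_sq M F g x \<and> cond_sq M F g x < \<infinity>"
  shows "cond_normalize K g \<in> borel_measurable M"
    and "AE x in M. cond_sq M F (cond_normalize K g) x = indicator K x"
proof -
  let ?c = "\<lambda>x. complex_of_real (if x \<in> K then 1 / sqrt (enn2real (cond_sq M F g x)) else 0)"
  have c [measurable]: "?c \<in> borel_measurable F" by measurable
  have [measurable]: "?c \<in> borel_measurable M" by (rule measurable_from_subalg[OF subalg c])
  have eq: "cond_normalize K g = (\<lambda>x. ?c x * g x)" by (rule ext) (simp only: cond_normalize_def)
  show "cond_normalize K g \<in> borel_measurable M" unfolding eq by measurable
  have "AE x in M. cond_sq M F (\<lambda>x. ?c x * g x) x = ennreal ((cmod (?c x))\<^sup>2) * cond_sq M F g x"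
    by (rule cond_sq_mult) measurable
  then show "AE x in M. cond_sq M F (cond_normalize K g) x = indicator K x"
    unfolding eq
  proof eventually_elim
    case (elim x)
    show ?case
    proof (cases "x \<in> K")
      case True
      then obtain r where r: "cond_sq M F g x = ennreal r" "r > 0"
        using pos[OF True] by (cases "cond_sq M F g x") auto
      then show ?thesis unfolding elim using True
        by (simp add: norm_divide power_divide ennreal_mult[symmetric])
    qed (simp add: elim)
  qed
qed

lemma ccond_exp_normalize:
  assumes [measurable]: "g \<in> borel_measurable M" "f \<in> borel_measurable M" and K [measurable]: "K \<in> sets F"
  shows "AE x in M. x \<in> K \<longrightarrow> nn_cond_exp M F (\<lambda>y. ennreal (cmod (g y * f y))) x < \<infinity> \<longrightarrow>
    ccond_exp M F (\<lambda>y. cond_normalize K g y * f y) x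
      = complex_of_real (1 / sqrt (enn2real (cond_sq M F g x))) * ccond_exp M F (\<lambda>y. g y * f y) x"
proof -
  let ?c = "\<lambda>x. complex_of_real (if x \<in> K then 1 / sqrt (enn2real (cond_sq M F g x)) else 0)"
  have eq: "(\<lambda>y. cond_normalize K g y * f y) = (\<lambda>y. ?c y * (g y * f y))"
    by (rule ext) (simp only: cond_normalize_def mult.assoc)
  have "AE x in M. nn_cond_exp M F (\<lambda>y. ennreal (cmod (g y * f y))) x < \<infinity> \<longrightarrow>
      ccond_exp M F (\<lambda>y. ?c y * (g y * f y)) x = ?c x * ccond_exp M F (\<lambda>y. g y * f y) x"
    by (rule ccond_exp_pull_out) measurable
  then show ?thesis unfolding eq by eventually_elim simp
qed

text \<open>\<open>g\<close> vanishes a.e. on this \<open>F\<close>-measurable set, so pulling out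
  its indicator gives the expectation of 0. It covers the points with \<open>q = 0 < p\<close>,
  which lie outside \<open>K\<close> but where \<open>w\<close> need not vanish.\<close>

lemma ccond_exp_zero_where_cond_sq_zero:
  assumes [measurable]: "g \<in> borel_measurable M" "f \<in> borel_measurable M"
  shows "AE x in M. cond_sq M F g x = 0 \<longrightarrow>
    nn_cond_exp M F (\<lambda>y. ennreal (cmod (g y * f y))) x < \<infinity> \<longrightarrow> ccond_exp M F (\<lambda>y. g y * f y) x = 0"
proof -
  let ?c = "\<lambda>x. if cond_sq M F g x = 0 then 1 else 0 :: complex"
  have zero: "ccond_exp M F (\<lambda>y. 0) x = 0" for x
    by (simp add: ccond_exp_def real_cond_exp_def complex_eq_iff)
  have "AE x in M. nn_cond_exp M F (\<lambda>y. ennreal (cmod (g y * f y))) x < \<infinity> \<longrightarrow>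
      ccond_exp M F (\<lambda>y. ?c y * (g y * f y)) x = ?c x * ccond_exp M F (\<lambda>y. g y * f y) x"
    by (rule ccond_exp_pull_out) measurable
  moreover have "AE x in M. ccond_exp M F (\<lambda>y. ?c y * (g y * f y)) x = ccond_exp M F (\<lambda>y. 0) x"
  proof (rule ccond_exp_cong)
    show "AE x in M. ?c x * (g x * f x) = 0"
      using zero_where_cond_sq_zero[OF assms(1)] by eventually_elim auto
  qed measurable
  ultimately show ?thesis
    by eventually_elim (auto simp: zero)
qed

end

theorem theorem2p5:
  fixes M A :: "'a measure" and u w :: "'a \<Rightarrow> complex" and S G :: "'a set"
    and absT U :: "('a \<Rightarrow> complex) \<Rightarrow> ('a \<Rightarrow> complex)"
  assumes "complete_measure M" and "sigma_finite_measure M"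
    and "subalgebra M A" and "sigma_finite_measure (restr_to_subalg M A)"
    and "u \<in> cond_exp_dom M A" and "w \<in> cond_exp_dom M A"
    and "wce_bounded M A w u"
    and S_def: "S = {x \<in> space M. cond_sq M A u x \<noteq> 0}"
    and G_def: "G = {x \<in> space M. cond_sq M A w x \<noteq> 0}"
    and absT_def: "absT = (\<lambda>f x.
          complex_of_real (sqrt (enn2real (cond_sq M A w x / cond_sq M A u x)))
            * indicator S x * cnj (u x) * ccond_exp M A (\<lambda>y. u y * f y) x)"
    and U_def: "U = (\<lambda>f x.
          complex_of_real (sqrt (enn2real
            (indicator (S \<inter> G) x / (cond_sq M A w x * cond_sq M A u x))))
            * w x * ccond_exp M A (\<lambda>y. u y * f y) x)"
  shows "L2_polar_decomp M (wce_op M A w u) U absT \<and>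
         (\<forall>U' P'. L2_polar_decomp M (wce_op M A w u) U' P' \<longrightarrow>
                    L2_op_eq M U' U \<and> L2_op_eq M P' absT)"
proof -
  interpret sigma_finite_subalgebra M A
    using assms(3,4) by (rule sigma_finite_subalgebra.intro)
  have um [measurable]: "u \<in> borel_measurable M" and wm [measurable]: "w \<in> borel_measurable M"
    using assms(5,6) by (auto simp: cond_exp_dom_def)
  define p where "p = cond_sq M A w"
  define q where "q = cond_sq M A u"
  have [measurable]: "p \<in> borel_measurable A" "q \<in> borel_measurable A"
    "p \<in> borel_measurable M" "q \<in> borel_measurable M"
    unfolding p_def q_def by measurable
  obtain C where C: "C > 0" "AE x in M. p x * q x \<le> ennreal C"
    using wce_bounded_imp_cond_sq_mult_le[OF um wm assms(7)] unfolding p_def q_def by metis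
  have space: "space A = space M" using assms(3) by (simp add: subalgebra_def)
  \<comment> \<open>The bounds are built into \<open>K\<close> so that the requirements on
    \<open>a\<close> hold at every point and not just a.e.\<close>
  define K where "K = {x \<in> space M. 0 < p x \<and> p x < \<infinity> \<and> 0 < q x \<and> q x < \<infinity> \<and> p x * q x \<le> ennreal C}"
  have "{x \<in> space A. 0 < p x \<and> p x < \<infinity> \<and> 0 < q x \<and> q x < \<infinity> \<and> p x * q x \<le> ennreal C} \<in> sets A"
    by measurable
  then have K [measurable]: "K \<in> sets A" by (simp only: K_def space)
  define a where "a = (\<lambda>x. if x \<in> K then sqrt (enn2real (p x * q x)) else 0)"
  have aA: "a \<in> borel_measurable A" unfolding a_def by measurable
  let ?v = "cond_normalize K w" and ?z = "cond_normalize K u"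
  have on_K: "\<exists>P Q. p x = ennreal P \<and> q x = ennreal Q \<and> 0 < P \<and> 0 < Q" if "x \<in> K" for x
    using that by (cases "p x"; cases "q x") (auto simp: K_def)
  have pos: "0 < enn2real (p x * q x) \<and> enn2real (p x * q x) \<le> C" if x: "x \<in> K" for x
  proof -
    obtain P Q where PQ: "p x = ennreal P" "q x = ennreal Q" "0 < P" "0 < Q"
      using on_K[OF x] by blast
    have "p x * q x \<le> ennreal C" using x by (simp add: K_def)
    with PQ C(1) show ?thesis by (simp add: ennreal_mult[symmetric])
  qed
  interpret normalized_wce M A K ?v ?z a "sqrt C"
  proof
    show "?v \<in> borel_measurable M" "AE x in M. cond_sq M A ?v x = indicator K x"
      using cond_sq_normalize[OF wm K] by (auto simp: K_def p_def)
    show "?z \<in> borel_measurable M" "AE x in M. cond_sq M A ?z x = indicator K x"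
      using cond_sq_normalize[OF um K] by (auto simp: K_def q_def)
    show "?z x = 0" if "x \<notin> K" for x using that by (simp add: cond_normalize_def)
    show "0 \<le> a x" "a x \<le> sqrt C" "0 < a x \<longleftrightarrow> x \<in> K" for x
      using pos[of x] C(1) by (auto simp: a_def)
  qed (rule K aA)+
  \<comment> \<open>If both are nonzero, a finite product forces both to be finite; so a point with
    \<open>p q \<le> C\<close> missing from \<open>K\<close> has a vanishing factor.\<close>
  have off_K: "AE x in M. x \<notin> K \<longrightarrow> p x = 0 \<or> q x = 0"
    using C(2) AE_space
  proof eventually_elim
    case (elim x)
    show ?case
    proof (intro impI, rule ccontr)
      assume "x \<notin> K" "\<not> (p x = 0 \<or> q x = 0)"
      then have "0 < p x" "0 < q x" by (auto simp: zero_less_iff_neq_zero)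
      moreover have "p x * q x < \<infinity>" using elim(1) by (rule le_less_trans) simp
      ultimately have "p x < \<infinity>" "q x < \<infinity>" by (auto simp: ennreal_mult_less_top)
      with \<open>0 < p x\<close> \<open>0 < q x\<close> elim \<open>x \<notin> K\<close> show False by (simp add: K_def)
    qed
  qed
  have w0: "AE x in M. p x = 0 \<longrightarrow> w x = 0" unfolding p_def by (rule zero_where_cond_sq_zero) measurable
  have fin: "AE x in M. p x > 0 \<longrightarrow> nn_cond_exp M A (\<lambda>y. ennreal (cmod (u y * f y))) x < \<infinity>" if "f \<in> L2 M" for f
    using assms(7) that by (simp add: wce_bounded_def p_def)
  have Ez: "AE x in M. x \<in> K \<longrightarrow> ccond_exp M A (\<lambda>y. ?z y * f y) x
      = complex_of_real (1 / sqrt (enn2real (q x))) * ccond_exp M A (\<lambda>y. u y * f y) x" if f: "f \<in> L2 M" for f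
    using ccond_exp_normalize[OF um L2_measurable[OF f] K] fin[OF f]
    by eventually_elim (simp add: q_def K_def)
  have Teq: "L2_op_eq M (wce_op M A w u) Top" unfolding L2_op_eq_def
  proof
    fix f assume f: "f \<in> L2 M"
    show "AE x in M. wce_op M A w u f x = Top f x"
      using Ez[OF f] off_K w0 fin[OF f] ccond_exp_zero_where_cond_sq_zero[OF um L2_measurable[OF f]]
    proof eventually_elim
      case (elim x)
      show ?case
      proof (cases "x \<in> K")
        case True
        from on_K[OF this] obtain P Q where PQ: "p x = ennreal P" "q x = ennreal Q" "0 < P" "0 < Q" by blast
        have "complex_of_real (sqrt (P * Q)) * complex_of_real (1 / sqrt P) * complex_of_real (1 / sqrt Q) = 1"
          unfolding of_real_mult[symmetric] using PQ by (simp add: real_sqrt_mult)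
        then show ?thesis
          using True elim(1) PQ
          by (simp add: wce_op_def cond_normalize_def a_def p_def[symmetric] ennreal_mult[symmetric])
      next
        case False
        \<comment> \<open>Where \<open>p = 0\<close> the weight \<open>w\<close> vanishes, whatever
          \<open>E(u f)\<close> is; where \<open>q = 0 < p\<close>, boundedness makes
          \<open>E(u f)\<close> defined and it vanishes with \<open>u\<close>.\<close>
        have "w x * ccond_exp M A (\<lambda>y. u y * f y) x = 0"
          using False elim by (cases "p x = 0") (auto simp: q_def zero_less_iff_neq_zero)
        with False show ?thesis by (simp add: wce_op_def a_def)
      qed
    qed
  qed
  have Peq: "L2_op_eq M absT Pop" unfolding L2_op_eq_def
  proof
    fix f assume f: "f \<in> L2 M"
    show "AE x in M. absT f x = Pop f x"
      using Ez[OF f] off_K AE_space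
    proof eventually_elim
      case (elim x)
      show ?case
      proof (cases "x \<in> K")
        case True
        from on_K[OF this] obtain P Q where PQ: "p x = ennreal P" "q x = ennreal Q" "0 < P" "0 < Q" by blast
        \<comment> \<open>\<open>a\<close> contributes \<open>sqrt (P * Q)\<close>; the weight
          \<open>cnj z\<close> and the expectation \<open>E(z f)\<close> contribute one factor
          \<open>1 / sqrt Q\<close> each.\<close>
        have "sqrt (P * Q) * (1 / sqrt Q) * (1 / sqrt Q) = sqrt (P / Q)"
          using PQ by (simp add: real_sqrt_mult real_sqrt_divide field_simps)
        then have "complex_of_real (sqrt (P / Q)) = complex_of_real (sqrt (P * Q)) * complex_of_real (1 / sqrt Q) * complex_of_real (1 / sqrt Q)"
          unfolding of_real_mult[symmetric] by simp
        moreover have "enn2real (p x / q x) = P / Q" using PQ by (simp add: divide_ennreal)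
        moreover have "x \<in> S" using True by (auto simp: S_def K_def q_def)
        ultimately show ?thesis
          using True elim(1) PQ
          by (simp add: absT_def wce_op_def cond_normalize_def a_def p_def[symmetric] q_def[symmetric]
              ennreal_mult[symmetric])
      next
        case False
        \<comment> \<open>Either \<open>q = 0\<close> and the indicator of \<open>S\<close>
          vanishes, or \<open>p = 0\<close> and the quotient does, even if \<open>q\<close> is
          infinite.\<close>
        have "absT f x = 0"
          using False elim(2) by (cases "q x = 0") (auto simp: absT_def S_def p_def q_def)
        with False show ?thesis by (simp add: wce_op_def a_def)
      qed
    qed
  qed
  have Ueq: "L2_op_eq M U Uop" unfolding L2_op_eq_def
  proof
    fix f assume f: "f \<in> L2 M"
    show "AE x in M. U f x = Uop f x"
      using Ez[OF f] off_K AE_space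
    proof eventually_elim
      case (elim x)
      show ?case
      proof (cases "x \<in> K")
        case True
        from on_K[OF this] obtain P Q where PQ: "p x = ennreal P" "q x = ennreal Q" "0 < P" "0 < Q" by blast
        have "x \<in> S \<inter> G" using True by (auto simp: S_def G_def K_def p_def q_def)
        then have "enn2real (indicator (S \<inter> G) x / (p x * q x)) = 1 / (P * Q)"
          using PQ divide_ennreal[of 1 "P * Q"] by (simp add: ennreal_mult[symmetric])
        then have "complex_of_real (sqrt (enn2real (indicator (S \<inter> G) x / (p x * q x))))
            = complex_of_real (1 / sqrt P) * complex_of_real (1 / sqrt Q)"
          by (simp add: real_sqrt_divide real_sqrt_mult)
        then show ?thesis
          using True elim(1) PQ
          by (simp add: U_def wce_op_def cond_normalize_def p_def[symmetric] q_def[symmetric])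
      next
        case False
        then have "x \<notin> S \<inter> G" using elim(2) by (auto simp: S_def G_def p_def q_def)
        then have "U f x = 0" by (simp add: U_def)
        with False show ?thesis by (simp add: wce_op_def cond_normalize_def)
      qed
    qed
  qed
  have "S \<in> sets M" "G \<in> sets M" unfolding S_def G_def by measurable
  then have [measurable]: "S \<in> sets M" "S \<inter> G \<in> sets M" by auto
  have meas: "wce_op M A w u f \<in> borel_measurable M" "U f \<in> borel_measurable M" "absT f \<in> borel_measurable M" for f
    unfolding U_def absT_def by measurable
  have d: "L2_polar_decomp M (wce_op M A w u) U absT"
    by (rule L2_polar_decomp_cong[OF polar_decomp Teq meas(1) Ueq meas(2) Peq meas(3)])
  have "L2_op_eq M U' U \<and> L2_op_eq M P' absT" if d': "L2_polar_decomp M (wce_op M A w u) U' P'" for U' P'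
  proof (rule L2_polar_decomp_unique[OF d d'])
    fix f and e :: real assume "f \<in> L2 M" "0 < e"
    then obtain g k where g: "g \<in> L2 M" and k: "k \<in> L2_ker M Pop"
      and small: "L2_norm M (\<lambda>x. f x - (Pop g x + k x)) < e"
      using Pop_range_ker_dense by blast
    have [measurable]: "f \<in> borel_measurable M" "g \<in> borel_measurable M" "k \<in> borel_measurable M"
      using \<open>f \<in> L2 M\<close> g k by (auto simp: L2_def L2_ker_def)
    have [measurable]: "Pop g \<in> borel_measurable M"
      by (rule L2_measurable[OF L2_bounded_opD(1)[OF L2_positive_bounded[OF Pop_positive] g]])
    have [measurable]: "absT g \<in> borel_measurable M" by (rule meas(3))
    have "L2_norm M (\<lambda>x. f x - (absT g x + k x)) = L2_norm M (\<lambda>x. f x - (Pop g x + k x))"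
    proof (rule L2_norm_cong_AE)
      show "AE x in M. f x - (absT g x + k x) = f x - (Pop g x + k x)"
        using L2_op_eqD[OF Peq g] by eventually_elim simp
    qed measurable
    with small g k L2_op_eq_ker[OF Peq]
    show "\<exists>g\<in>L2 M. \<exists>k\<in>L2_ker M absT. L2_norm M (\<lambda>x. f x - (absT g x + k x)) < e" by metis
  qed
  with d show ?thesis by blast
qed

end
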